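(* Let $d\ge1$ be an integer and let $s\in(-d,1)$. Let $u:\mathbb{R}^d\times[0,\infty)\to\mathbb{R}$ be such that its even extension $\tilde u$ in the last variable belongs to $\mathcal{S}(\mathbb{R}^{d+1})$. For $N\in\mathbb{N}$, $N\ge1$, write points of $\mathbb{R}^{d+N}$ as $(x,y)$ with $x\in\mathbb{R}^d$, $y\in\mathbb{R}^N$. (i) For every $N\in\mathbb{N}$, $N\ge1$, the function $(-\Delta_{x,y})^s\left[u\big(x,\frac{|y|^2}{2N}\big)\right]$ is a function only of $\big(x,\frac{|y|^2}{2N}\big)$. (ii) Let $G_N:\mathbb{R}^d\times[0,\infty)\to\mathbb{R}$ be such that $$G_N\Big(x,\frac{|y|^2}{2N}\Big)=(-\Delta_{x,y})^s\left[u\Big(x,\frac{|y|^2}{2N}\Big)\right].$$ Then, pointwise for $(x,t)\in\mathbb{R}^d\times[0,\infty)$, $$G_N(x,t)\to(-\Delta_x-\partial_t)^{s}[u(x,t)]\quad\text{as }N\to\infty.$$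
   Context: The even extension of $u:\mathbb{R}^d\times[0,\infty)\to\mathbb{R}$ is $\tilde u(x,t)=u(x,t)$ for $t\ge 0$ and $\tilde u(x,t)=u(x,-t)$ for $t<0$, $x\in\mathbb{R}^d$. $\mathcal{S}(\mathbb{R}^{n})$ is the Schwartz space of real-valued smooth rapidly decaying functions. $\Delta_{x,y}=\sum_{i=1}^d\partial_{x_i}^2+\sum_{i=1}^N\partial_{y_i}^2$ on functions on $\mathbb{R}^{d+N}$. Fractional Laplacian on $\mathbb{R}^n$ (here $n=d+N$), defined by subordination: let $U(z,\tau)$ be the solution of the heat equation $\partial_\tau U=\Delta U$ on $\mathbb{R}^n$ with $U(z,0)=f(z)$ (the Gaussian convolution of $f$). For $s\in(0,1)$, $(-\Delta)^sf(z)=\frac{1}{\Gamma(-s)}\int_0^\infty(U(z,\tau)-f(z))\frac{d\tau}{\tau^{1+s}}$; for $0<\sigma<n$, $(-\Delta)^{-\sigma}f(z)=\frac{1}{\Gamma(\sigma)}\int_0^\infty U(z,\tau)\frac{d\tau}{\tau^{1-\sigma}}$; $(-\Delta)^0f=f$. Fractional powers of the backward heat operator: for $u:\mathbb{R}^d\times[0,\infty)\to\mathbb{R}$ let $V$ be the bounded solution of $\partial_\tau V=\Delta_xV+\partial_tV$ for $x\in\mathbb{R}^d$, $t>0$, $\tau>0$, with $V(x,0,\tau)=\frac{1}{(4\pi\tau)^{d/2}}\int_{\mathbb{R}^d}e^{-\frac{|x-\overline x|^2}{4\tau}}u(\overline x,\tau)\,d\overline x$ for $x\in\mathbb{R}^d$,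 $\tau>0$, and $V(x,t,0)=u(x,t)$ for $x\in\mathbb{R}^d$, $t\ge0$; explicitly $V(x,t,\tau)=\frac{1}{(4\pi\tau)^{d/2}}\int_{\mathbb{R}^d}e^{-\frac{|\overline x|^2}{4\tau}}u(x-\overline x,t+\tau)\,d\overline x$. For $s\in(0,1)$, $(-\Delta_x-\partial_t)^s[u(x,t)]=\frac{1}{\Gamma(-s)}\int_0^\infty(V(x,t,\tau)-u(x,t))\frac{d\tau}{\tau^{1+s}}$; for $\sigma\in(0,d)$, $(-\Delta_x-\partial_t)^{-\sigma}[u(x,t)]=\frac{1}{\Gamma(\sigma)}\int_0^\infty V(x,t,\tau)\frac{d\tau}{\tau^{1-\sigma}}$; for $s=0$ the operator is the identity. *)

theory Defs
  imports "HOL-Analysis.Analysis"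
begin

primrec iterated_partial :: "'a list \<Rightarrow> ('a::euclidean_space \<Rightarrow> real) \<Rightarrow> 'a \<Rightarrow> real" where
  "iterated_partial [] f = f"
| "iterated_partial (b # bs) f = (\<lambda>z. frechet_derivative (iterated_partial bs f) (at z) b)"

text \<open>
  (Frechet) differentiability of the iterated partial derivatives of every order, including \<open>f\<close>
  itself, is smoothness of \<open>f\<close>, and makes \<^const>\<open>frechet_derivative\<close> the genuine derivative above.
\<close>

definition schwartz :: "('a::euclidean_space \<Rightarrow> real) \<Rightarrow> bool" where
  "schwartz f \<longleftrightarrow>
     (\<forall>bs. set bs \<subseteq> Basis \<longrightarrow>
        iterated_partial bs f differentiable_on UNIV \<and>
        (\<forall>k::nat. bounded (range (\<lambda>z. norm z ^ k * iterated_partial bs f z))))"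

text \<open>
  Functions on \<open>\<real>\<^sup>d \<times> [0, \<infinity>)\<close> are modelled as functions on \<open>\<real>\<^sup>d \<times> \<real>\<close>;
  their values at negative times are never used.
\<close>

definition even_extension :: "('a \<times> real \<Rightarrow> real) \<Rightarrow> 'a \<times> real \<Rightarrow> real" where
  "even_extension u = (\<lambda>(x, t). if t \<ge> 0 then u (x, t) else u (x, - t))"

text \<open>
  Since \<open>N\<close> varies, \<open>\<real>\<^sup>N\<close> cannot be a type depending on \<open>N\<close>. It is represented by the functions on
  \<open>{..<N}\<close> (set to \<open>undefined\<close> elsewhere), with the product Lebesgue measure, and
  \<open>L2_set y {..<N}\<close> is the Euclidean norm of \<open>y\<close>.
\<close>

definition Rn :: "nat \<Rightarrow> (nat \<Rightarrow> real) set" where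
  "Rn N = {..<N} \<rightarrow>\<^sub>E UNIV"

definition lebesgue_prod :: "nat \<Rightarrow> ('a::euclidean_space \<times> (nat \<Rightarrow> real)) measure" where
  "lebesgue_prod N = lborel \<Otimes>\<^sub>M (\<Pi>\<^sub>M i\<in>{..<N}. lborel)"

text \<open>The heat semigroup on \<open>\<real>\<^sup>d \<times> \<real>\<^sup>N\<close> at time \<open>\<tau> > 0\<close>.\<close>

definition heat ::
  "nat \<Rightarrow> ('a::euclidean_space \<times> (nat \<Rightarrow> real) \<Rightarrow> real) \<Rightarrow> 'a \<times> (nat \<Rightarrow> real) \<Rightarrow> real \<Rightarrow> real" where
  "heat N f = (\<lambda>(x, y) \<tau>.
     1 / (4 * pi * \<tau>) powr (real (DIM('a) + N) / 2) *
     (LINT (x', y')|lebesgue_prod N.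
        exp (- (norm (x - x') ^ 2 + L2_set (\<lambda>i. y i - y' i) {..<N} ^ 2) / (4 * \<tau>)) * f (x', y')))"

text \<open>
  \<open>(-\<Delta>)\<^sup>s\<close> on \<open>\<real>\<^sup>d \<times> \<real>\<^sup>N\<close>, for \<open>s < 1\<close>. As usual, the integral is \<open>0\<close> where it does not converge
  absolutely; for negative \<open>s\<close> and rapidly decaying \<open>f\<close> this can only happen for \<open>- 2 * s \<ge> d + N\<close>.
\<close>

definition frac_laplacian ::
  "nat \<Rightarrow> real \<Rightarrow> ('a::euclidean_space \<times> (nat \<Rightarrow> real) \<Rightarrow> real) \<Rightarrow> 'a \<times> (nat \<Rightarrow> real) \<Rightarrow> real" where
  "frac_laplacian N s f z =
     (if s > 0 then
        1 / Gamma (- s) * (LINT \<tau>:{0<..}|lborel. (heat N f z \<tau> - f z) / \<tau> powr (1 + s))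
      else if s < 0 then
        let \<sigma> = - s in 1 / Gamma \<sigma> * (LINT \<tau>:{0<..}|lborel. heat N f z \<tau> / \<tau> powr (1 - \<sigma>))
      else f z)"

text \<open>
  The solution \<open>V\<close> of \<open>\<partial>\<^sub>\<tau> V = \<Delta>\<^sub>x V + \<partial>\<^sub>t V\<close> with \<open>V (x, t) 0 = u (x, t)\<close>, at \<open>\<tau> > 0\<close>.
\<close>

definition backward_heat ::
  "('a::euclidean_space \<times> real \<Rightarrow> real) \<Rightarrow> 'a \<times> real \<Rightarrow> real \<Rightarrow> real" where
  "backward_heat u = (\<lambda>(x, t) \<tau>.
     1 / (4 * pi * \<tau>) powr (real DIM('a) / 2) *
     (LINT x'|lborel. exp (- (norm x' ^ 2) / (4 * \<tau>)) * u (x - x', t + \<tau>)))"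

definition frac_backward_heat ::
  "real \<Rightarrow> ('a::euclidean_space \<times> real \<Rightarrow> real) \<Rightarrow> 'a \<times> real \<Rightarrow> real" where
  "frac_backward_heat s u z =
     (if s > 0 then
        1 / Gamma (- s) * (LINT \<tau>:{0<..}|lborel. (backward_heat u z \<tau> - u z) / \<tau> powr (1 + s))
      else if s < 0 then
        let \<sigma> = - s in 1 / Gamma \<sigma> * (LINT \<tau>:{0<..}|lborel. backward_heat u z \<tau> / \<tau> powr (1 - \<sigma>))
      else u z)"

definition radial_lift :: "nat \<Rightarrow> ('a \<times> real \<Rightarrow> real) \<Rightarrow> 'a \<times> (nat \<Rightarrow> real) \<Rightarrow> real" where
  "radial_lift N u = (\<lambda>(x, y). u (x, L2_set y {..<N} ^ 2 / (2 * real N)))"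

end

theory Submission
  imports Defs "HOL-Probability.Probability"
begin

text \<open>
  The heat semigroup on \<open>\<real>\<^sup>d \<times> \<real>\<^sup>N\<close> is an expectation: \<open>heat N f (x, y) \<tau>\<close> is the mean of
  \<open>f\<close> at a Gaussian point \<open>(x', w)\<close> centred at \<open>(x, y)\<close> whose coordinates are independent with
  variance \<open>2 \<tau>\<close>. On a radial lift the Gaussian vector \<open>w\<close> enters only through the random time
  \<open>R = |w|\<^sup>2 / (2 N)\<close>. If \<open>|y|\<^sup>2 / (2 N) = t\<close>, then \<open>R\<close> has mean exactly \<open>t + \<tau>\<close> and variance
  \<open>(4 t \<tau> + 2 \<tau>\<^sup>2) / N\<close>. By the law of large numbers \<open>R\<close> concentrates at \<open>t + \<tau>\<close>, and the mean of
  \<open>u (x', R)\<close> becomes the mean of \<open>u (x', t + \<tau>)\<close>, which is \<open>backward_heat u (x, t) \<tau>\<close>.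
  Diffusion in infinitely many radial directions thus turns into transport in time. Only values of
  \<open>u\<close> at nonnegative times occur, so \<open>u\<close> may be replaced by its even extension, which is smooth on
  the whole space.

  Radiality is the statement that the law of \<open>R\<close> depends on \<open>y\<close> only through \<open>|y|\<close>. Its Laplace
  transform is explicit (\<open>gauss_laplace\<close>) and visibly depends on \<open>|y|\<^sup>2\<close> alone, and expectations of
  continuous functions vanishing at infinity are determined by the Laplace transform
  (\<open>laplace_transform_determines_expectation\<close>); this replaces any use of rotations of \<open>\<real>\<^sup>N\<close>.

  For the limit it remains to pass from the heat semigroups to the integrals over
  \<open>0 < \<tau> < \<infinity>\<close> with weight \<open>\<tau> powr - (1 + s)\<close> by dominated convergence, so all bounds must be uniform
  in \<open>N\<close>. Since \<open>R - (t + \<tau>)\<close> has mean zero, a second-order Taylor expansion in time gives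
  \<open>heat - backward_heat = O ((4 t \<tau> + 2 \<tau>\<^sup>2) / N)\<close> (\<open>heat_near_backward_heat\<close>). This yields pointwise
  convergence and, together with \<open>backward_heat - u = O (\<tau>)\<close>
  (\<open>backward_heat_near_initial_value\<close>), integrability at \<open>\<tau> = 0\<close> when \<open>0 < s\<close>. When \<open>s < 0\<close> the critical
  end is \<open>\<tau> = \<infinity>\<close>, where decay like \<open>\<tau> ^ - d\<close> covers the whole range \<open>- d < s\<close>. The diffusion in \<open>x\<close> alone would give
  only half of this exponent; instead the decay of \<open>u\<close> in time is used, because a Chernoff bound makes
  the event \<open>R \<le> sqrt \<tau>\<close> improbable to any polynomial order, uniformly in large \<open>N\<close>
  (\<open>heat_radial_lift_decay\<close>).
\<close>

section \<open>Schwartz functions\<close>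

lemma schwartz_partial_bounded:
  assumes "schwartz v" "set bs \<subseteq> Basis"
  obtains B where "\<And>z. norm z ^ k * \<bar>iterated_partial bs v z\<bar> \<le> B"
proof -
  have "bounded (range (\<lambda>z. norm z ^ k * iterated_partial bs v z))"
    using assms by (auto simp: schwartz_def)
  then obtain B where "\<And>z. \<bar>norm z ^ k * iterated_partial bs v z\<bar> \<le> B"
    by (auto simp: bounded_iff)
  then show ?thesis by (intro that[of B]) (simp add: abs_mult)
qed

lemma schwartz_differentiable:
  assumes "schwartz v" "set bs \<subseteq> Basis"
  shows "(iterated_partial bs v has_derivative frechet_derivative (iterated_partial bs v) (at z)) (at z)"
  using assms by (auto simp: schwartz_def differentiable_on_def frechet_derivative_works[symmetric])

lemma schwartz_decay:
  assumes v: "schwartz (v :: 'a::euclidean_space \<times> real \<Rightarrow> real)"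
  obtains C where "C > 0" "\<And>z. \<bar>v z\<bar> \<le> C" "\<And>x r. \<bar>v (x, r)\<bar> * \<bar>r\<bar> ^ k \<le> C"
proof -
  obtain A where A: "\<And>z. norm z ^ 0 * \<bar>iterated_partial [] v z\<bar> \<le> A"
    by (rule schwartz_partial_bounded[OF v, of "[]" 0]) auto
  obtain B where B: "\<And>z. norm z ^ k * \<bar>iterated_partial [] v z\<bar> \<le> B"
    by (rule schwartz_partial_bounded[OF v, of "[]" k]) auto
  have "\<bar>v (x, r)\<bar> * \<bar>r\<bar> ^ k \<le> max 1 (max A B)" for x r
  proof -
    have "\<bar>r\<bar> ^ k \<le> norm (x, r) ^ k"
      using norm_snd_le[of "(x, r)"] by (intro power_mono) (auto simp: norm_Pair)
    then have "\<bar>v (x, r)\<bar> * \<bar>r\<bar> ^ k \<le> norm (x, r) ^ k * \<bar>v (x, r)\<bar>"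
      by (subst mult.commute) (intro mult_right_mono, auto)
    also have "\<dots> \<le> B" using B[of "(x, r)"] by simp
    finally show ?thesis by simp
  qed
  moreover have "\<bar>v z\<bar> \<le> max 1 (max A B)" for z
    using A[of z] by simp
  ultimately show ?thesis by (intro that[of "max 1 (max A B)"]) auto
qed

lemma gradient_bound:
  fixes f :: "'a::euclidean_space \<Rightarrow> real" and B :: real
  assumes f: "linear f" and b: "\<And>b. b \<in> Basis \<Longrightarrow> \<bar>f b\<bar> \<le> B"
  shows "\<bar>f w\<bar> \<le> DIM('a) * B * norm w"
proof -
  have "f w = (\<Sum>b\<in>Basis. (w \<bullet> b) * f b)"
    by (subst euclidean_representation[of w, symmetric]) (simp only: linear_sum[OF f] linear_scale[OF f] real_scaleR_def)
  also have "\<bar>\<dots>\<bar> \<le> (\<Sum>b\<in>(Basis::'a set). norm w * B)"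
    by (rule order_trans[OF sum_abs], rule sum_mono)
      (auto simp: abs_mult intro!: mult_mono b Basis_le_norm)
  finally show ?thesis by (simp add: mult_ac)
qed

text \<open>
  The entries of the Hessian are bounded, so every partial derivative is Lipschitz by the mean value
  theorem; a second application of the mean value theorem, to \<open>v\<close> minus its linearization, gives the
  quadratic remainder. The constant is independent of the base point, which is what makes
  the error estimates below uniform in \<open>x\<close>.
\<close>

lemma schwartz_second_order_taylor:
  fixes v :: "'a::euclidean_space \<Rightarrow> real"
  assumes v: "schwartz v"
  obtains L where "L \<ge> 0"
    "\<And>z z'. \<bar>v z' - v z - frechet_derivative v (at z) (z' - z)\<bar> \<le> L * (norm (z' - z))\<^sup>2"
proof -
  have "\<forall>b\<in>Basis. \<forall>c\<in>Basis. \<exists>B. \<forall>z. \<bar>iterated_partial [c, b] v z\<bar> \<le> B"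
  proof (intro ballI)
    fix b c :: 'a assume "b \<in> Basis" "c \<in> Basis"
    then show "\<exists>B. \<forall>z. \<bar>iterated_partial [c, b] v z\<bar> \<le> B"
      using schwartz_partial_bounded[OF v, of "[c, b]" 0] by auto
  qed
  then obtain K where K: "\<And>b c z. b \<in> Basis \<Longrightarrow> c \<in> Basis \<Longrightarrow> \<bar>iterated_partial [c, b] v z\<bar> \<le> K b c"
    by metis
  define B where "B = (\<Sum>b\<in>Basis. \<Sum>c\<in>Basis. \<bar>K b c\<bar>)"
  have B: "\<bar>iterated_partial [c, b] v z\<bar> \<le> B" if "b \<in> Basis" "c \<in> Basis" for b c z
  proof -
    have "K b c \<le> (\<Sum>c\<in>Basis. \<bar>K b c\<bar>)"
      using member_le_sum[of c Basis "\<lambda>c. \<bar>K b c\<bar>"] that by auto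
    also have "\<dots> \<le> B"
      unfolding B_def
      using member_le_sum[of b Basis "\<lambda>b. \<Sum>c\<in>Basis. \<bar>K b c\<bar>"] that by (auto simp: sum_nonneg)
    finally show ?thesis using K[OF that, of z] by linarith
  qed
  have B0: "B \<ge> 0" by (simp add: B_def sum_nonneg)
  define n where "n = real DIM('a)"
  let ?D = "\<lambda>z. frechet_derivative v (at z)"
  have lip: "\<bar>?D z' b - ?D z b\<bar> \<le> n * B * norm (z' - z)" if b: "b \<in> Basis" for z z' b
  proof -
    let ?D2 = "\<lambda>z. frechet_derivative (iterated_partial [b] v) (at z)"
    have der: "(iterated_partial [b] v has_derivative ?D2 z) (at z)" for z
      using b by (intro schwartz_differentiable[OF v]) auto
    have "onorm (?D2 z) \<le> n * B" for z
    proof (rule onorm_le)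
      fix w
      have "\<bar>?D2 z w\<bar> \<le> DIM('a) * B * norm w"
        using gradient_bound[OF has_derivative_linear[OF der[of z]], of B w] B[OF b] by auto
      then show "norm (?D2 z w) \<le> n * B * norm w" by (simp add: n_def)
    qed
    then have "norm (iterated_partial [b] v z' - iterated_partial [b] v z) \<le> n * B * norm (z' - z)"
      using der by (intro differentiable_bound[of UNIV _ ?D2]) auto
    then show ?thesis by simp
  qed
  show ?thesis
  proof (rule that[of "n * (n * B)"])
    show "n * (n * B) \<ge> 0" using B0 by (simp add: n_def)
    fix z z' :: 'a
    have der: "(v has_derivative ?D y) (at y)" for y
      using schwartz_differentiable[OF v, of "[]"] by simp
    have "norm (v z' - v z - ?D z (z' - z)) \<le> norm (z' - z) * (n * (n * B * norm (z' - z)))"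
    proof (rule differentiable_bound_linearization[where S = "cball z (norm (z' - z))"])
      show "z + t *\<^sub>R (z' - z) \<in> cball z (norm (z' - z))" if "t \<in> {0..1}" for t
        using that by (auto simp: dist_norm mult_left_le_one_le)
      show "(v has_derivative ?D y) (at y within cball z (norm (z' - z)))" for y
        by (rule has_derivative_at_withinI[OF der])
      fix y assume y: "y \<in> cball z (norm (z' - z))"
      then have y: "norm (y - z) \<le> norm (z' - z)" by (simp add: dist_norm norm_minus_commute)
      show "onorm (?D y - ?D z) \<le> n * (n * B * norm (z' - z))"
      proof (rule onorm_le)
        fix w
        have "\<bar>(?D y - ?D z) b\<bar> \<le> n * B * norm (z' - z)" if "b \<in> Basis" for b
        proof -
          have "\<bar>(?D y - ?D z) b\<bar> \<le> n * B * norm (y - z)"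
            using lip[OF that, of y z] by simp
          also have "\<dots> \<le> n * B * norm (z' - z)"
            using y B0 by (intro mult_left_mono) (auto simp: n_def)
          finally show ?thesis .
        qed
        moreover have "linear (?D y - ?D z)"
          unfolding fun_diff_def
          by (intro linear_compose_sub has_derivative_linear[OF der])
        ultimately show "norm ((?D y - ?D z) w) \<le> n * (n * B * norm (z' - z)) * norm w"
          using gradient_bound[of "?D y - ?D z" "n * B * norm (z' - z)" w] by (simp add: n_def)
      qed
    qed simp
    then show "\<bar>v z' - v z - ?D z (z' - z)\<bar> \<le> n * (n * B) * (norm (z' - z))\<^sup>2"
      by (simp add: power2_eq_square mult_ac)
  qed
qed


section \<open>Laplace transforms of nonnegative random variables\<close>

text \<open>
  A uniform approximation of \<open>g\<close> by exponential sums on the half-line bounds the expectation of \<open>g\<close> in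
  terms of finitely many values of the Laplace transform.
\<close>

lemma expectation_near_exponential_sum:
  fixes g :: "real \<Rightarrow> real"
  assumes "prob_space M" and X [measurable]: "X \<in> borel_measurable M" and nonneg: "\<And>w. X w \<ge> 0"
    and g: "continuous_on UNIV g"
    and close: "\<And>r. r \<ge> 0 \<Longrightarrow> \<bar>g r - (\<Sum>i\<le>n. a i * exp (- real i * r))\<bar> \<le> e"
  shows "\<bar>(\<integral>w. g (X w) \<partial>M) - (\<Sum>i\<le>n. a i * (\<integral>w. exp (- real i * X w) \<partial>M))\<bar> \<le> e"
proof -
  interpret M: prob_space M by fact
  have [measurable]: "g \<in> borel_measurable borel" using g by (rule borel_measurable_continuous_onI)
  let ?p = "\<lambda>w. \<Sum>i\<le>n. a i * exp (- real i * X w)"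
  have int_exp: "integrable M (\<lambda>w. exp (- real i * X w))" for i
    by (rule M.integrable_const_bound[where B=1]) (auto simp: nonneg)
  then have intp: "integrable M ?p" by auto
  have intd: "integrable M (\<lambda>w. g (X w) - ?p w)"
    by (rule M.integrable_const_bound[where B=e]) (use close nonneg in auto)
  have intg: "integrable M (\<lambda>w. g (X w))"
    using Bochner_Integration.integrable_add[OF intd intp] by simp
  have "(\<Sum>i\<le>n. a i * (\<integral>w. exp (- real i * X w) \<partial>M)) = (\<integral>w. ?p w \<partial>M)"
    using int_exp by (subst Bochner_Integration.integral_sum) auto
  then have "(\<integral>w. g (X w) \<partial>M) - (\<Sum>i\<le>n. a i * (\<integral>w. exp (- real i * X w) \<partial>M))
      = (\<integral>w. g (X w) - ?p w \<partial>M)" using intg intp by simp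
  also have "\<bar>\<dots>\<bar> \<le> (\<integral>w. \<bar>g (X w) - ?p w\<bar> \<partial>M)" by (rule integral_abs_bound)
  also have "\<dots> \<le> e"
    by (rule M.integral_le_const) (use intd close nonneg in auto)
  finally show ?thesis .
qed

text \<open>
  The substitution \<open>s = exp (- r)\<close> turns \<open>g\<close> into a function on \<open>[0, 1]\<close>, continuous with value
  \<open>0\<close> at \<open>s = 0\<close> because \<open>g\<close> vanishes at infinity. By the Weierstrass theorem it is a uniform limit of
  polynomials in \<open>s\<close>, whose expectations are combinations of the values of the Laplace transform at the
  natural numbers.
\<close>

lemma laplace_transform_determines_expectation:
  fixes X :: "'a \<Rightarrow> real" and Y :: "'b \<Rightarrow> real" and g :: "real \<Rightarrow> real"
  assumes "prob_space M" "prob_space M'"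
    and X [measurable]: "X \<in> borel_measurable M" and Y [measurable]: "Y \<in> borel_measurable M'"
    and nonneg: "\<And>w. X w \<ge> 0" "\<And>w. Y w \<ge> 0"
    and laplace: "\<And>n::nat. (\<integral>w. exp (- real n * X w) \<partial>M) = (\<integral>w. exp (- real n * Y w) \<partial>M')"
    and g: "continuous_on UNIV g" and g0: "(g \<longlongrightarrow> 0) at_top"
  shows "(\<integral>w. g (X w) \<partial>M) = (\<integral>w. g (Y w) \<partial>M')"
proof -
  interpret M: prob_space M by fact
  interpret M': prob_space M' by fact
  define h where "h s = (if s \<le> 0 then 0 else g (- ln s))" for s :: real
  have h_exp: "h (exp (- r)) = g r" for r by (simp add: h_def)
  have cont: "continuous_on {0..1} h"
  proof (rule continuous_on_eq_continuous_within[THEN iffD2], rule ballI)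
    fix s :: real assume s: "s \<in> {0..1}"
    show "continuous (at s within {0..1}) h"
    proof (cases "s = 0")
      case True
      have "filterlim (\<lambda>s::real. - ln s) at_top (at_right 0)" by real_asymp
      then have "((\<lambda>s. g (- ln s)) \<longlongrightarrow> 0) (at_right 0)"
        by (rule filterlim_compose[OF g0])
      then have "(h \<longlongrightarrow> 0) (at_right 0)"
        by (rule Lim_transform_eventually) (auto simp: h_def eventually_at_right_less eventually_at_filter)
      moreover have "at 0 within {0..1::real} \<le> at_right 0"
        by (simp add: at_within_Icc_at_right)
      ultimately show ?thesis
        unfolding True continuous_within by (auto simp: h_def intro: tendsto_mono)
    next
      case False
      with s have pos: "s > 0" by simp
      have "continuous_on {0<..} (\<lambda>s. g (- ln s))"
        by (rule continuous_on_compose2[OF g]) (auto intro!: continuous_intros)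
      then have "continuous_on {0<..} h"
        by (rule continuous_on_eq) (auto simp: h_def)
      then have "isCont h s" using pos by (simp add: continuous_on_eq_continuous_at)
      then show ?thesis by (rule continuous_at_imp_continuous_at_within)
    qed
  qed
  have "\<bar>(\<integral>w. g (X w) \<partial>M) - (\<integral>w. g (Y w) \<partial>M')\<bar> \<le> e" if e: "e > 0" for e
  proof -
    \<comment> \<open>The polynomial in s = exp (- r) becomes an exponential sum in r.\<close>
    obtain p where p: "real_polynomial_function p" "\<And>s. s \<in> {0..1} \<Longrightarrow> \<bar>h s - p s\<bar> < e / 2"
      using Stone_Weierstrass_real_polynomial_function[OF compact_Icc cont, of "e / 2"] e by auto
    then obtain a n where pa: "p = (\<lambda>s. \<Sum>i\<le>n. a i * s ^ i)"
      using real_polynomial_function_iff_sum by blast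
    have "\<bar>g r - (\<Sum>i\<le>n. a i * exp (- real i * r))\<bar> \<le> e / 2" if "r \<ge> 0" for r
      using p(2)[of "exp (- r)"] that by (simp add: h_exp pa exp_of_nat_mult[symmetric])
    note near = expectation_near_exponential_sum[OF _ _ _ g this]
    show ?thesis
      using near[OF assms(1) X nonneg(1)] near[OF assms(2) Y nonneg(2)] unfolding laplace by linarith
  qed
  then have "\<bar>(\<integral>w. g (X w) \<partial>M) - (\<integral>w. g (Y w) \<partial>M')\<bar> \<le> 0"
    by (rule field_le_epsilon) simp
  then show ?thesis by simp
qed


section \<open>Dominated convergence against a power weight\<close>

lemma power_weight_integrable:
  fixes a b p :: real
  assumes a: "a - p > -1" and b: "b - p < -1"
  shows "set_integrable lborel {0<..} (\<lambda>\<tau>. (if \<tau> \<le> 1 then \<tau> powr a else \<tau> powr b) / \<tau> powr p)"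
proof -
  have lb: "set_integrable lborel S (\<lambda>\<tau>. \<tau> powr e)"
    if "(\<lambda>\<tau>. \<tau> powr e) integrable_on S" "S \<in> sets borel" for S and e :: real
  proof -
    have "(\<lambda>\<tau>. \<tau> powr e) absolutely_integrable_on S"
      using that by (intro nonnegative_absolutely_integrable_1) auto
    then show ?thesis
      unfolding set_integrable_def using that(2) by (subst (asm) integrable_completion) auto
  qed
  have "set_integrable lborel {0<..1} (\<lambda>\<tau>. \<tau> powr (a - p))"
    using a by (intro lb integrable_on_powr_from_0') auto
  then have 1: "set_integrable lborel {0<..1} (\<lambda>\<tau>. (if \<tau> \<le> 1 then \<tau> powr a else \<tau> powr b) / \<tau> powr p)"
    by (subst set_integrable_cong[OF refl refl]) (auto simp: powr_diff)
  have "set_integrable lborel {1..} (\<lambda>\<tau>. \<tau> powr (b - p))"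
    using has_integral_powr_to_inf[OF b, of 1] by (intro lb) (auto simp: integrable_on_def)
  then have "set_integrable lborel {1<..} (\<lambda>\<tau>. \<tau> powr (b - p))"
    by (rule set_integrable_subset) auto
  then have 2: "set_integrable lborel {1<..} (\<lambda>\<tau>. (if \<tau> \<le> 1 then \<tau> powr a else \<tau> powr b) / \<tau> powr p)"
    by (subst set_integrable_cong[OF refl refl]) (auto simp: powr_diff)
  have "{0<..} = {0<..1} \<union> {1::real<..}" by auto
  then show ?thesis using set_integrable_Un[OF 1 2] by simp
qed

text \<open>
  The two exponents separate the regimes of the subordination integrals: \<open>a\<close> controls the singularity
  of the weight at \<open>\<tau> = 0\<close> and \<open>b\<close> the tail. The bound is asked only from an index \<open>n0\<close> on,
  since the large-time decay of radial lifts sets in only when the dimension is large.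
\<close>

lemma tendsto_singular_integral:
  fixes F :: "nat \<Rightarrow> real \<Rightarrow> real" and a b p :: real
  assumes a: "a - p > -1" and b: "b - p < -1"
    and meas [measurable]: "\<And>n. F n \<in> borel_measurable borel"
    and lim: "\<And>\<tau>. \<tau> > 0 \<Longrightarrow> (\<lambda>n. F n \<tau>) \<longlonglongrightarrow> G \<tau>"
    and bound: "\<And>n \<tau>. n \<ge> n0 \<Longrightarrow> \<tau> > 0 \<Longrightarrow> \<bar>F n \<tau>\<bar> \<le> C * (if \<tau> \<le> 1 then \<tau> powr a else \<tau> powr b)"
  shows "(\<lambda>n. LINT \<tau>:{0<..}|lborel. F n \<tau> / \<tau> powr p) \<longlonglongrightarrow> (LINT \<tau>:{0<..}|lborel. G \<tau> / \<tau> powr p)"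
proof (rule LIMSEQ_offset[of _ n0])
  let ?w = "\<lambda>\<tau>. C * ((if \<tau> \<le> 1 then \<tau> powr a else \<tau> powr b) / \<tau> powr p)"
  have lim': "(\<lambda>n. indicat_real {0<..} \<tau> *\<^sub>R (F (n + n0) \<tau> / \<tau> powr p)) \<longlonglongrightarrow> indicat_real {0<..} \<tau> *\<^sub>R (G \<tau> / \<tau> powr p)" for \<tau>
    using LIMSEQ_ignore_initial_segment[OF lim, of \<tau> n0]
    by (cases "\<tau> > 0") (auto intro!: tendsto_intros)
  show "(\<lambda>n. LINT \<tau>:{0<..}|lborel. F (n + n0) \<tau> / \<tau> powr p) \<longlonglongrightarrow> (LINT \<tau>:{0<..}|lborel. G \<tau> / \<tau> powr p)"
    unfolding set_lebesgue_integral_def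
  proof (rule integral_dominated_convergence)
    show "(\<lambda>\<tau>. indicat_real {0<..} \<tau> *\<^sub>R (F (n + n0) \<tau> / \<tau> powr p)) \<in> borel_measurable lborel" for n
      by measurable
    then show "(\<lambda>\<tau>. indicat_real {0<..} \<tau> *\<^sub>R (G \<tau> / \<tau> powr p)) \<in> borel_measurable lborel"
      by (rule borel_measurable_LIMSEQ_real[rotated]) (rule lim')
    show "integrable lborel (\<lambda>\<tau>. indicat_real {0<..} \<tau> *\<^sub>R ?w \<tau>)"
      using set_integrable_mult_right[OF power_weight_integrable[OF a b], of C]
      by (simp add: set_integrable_def)
    show "AE \<tau> in lborel. norm (indicat_real {0<..} \<tau> *\<^sub>R (F (n + n0) \<tau> / \<tau> powr p)) \<le> indicat_real {0<..} \<tau> *\<^sub>R ?w \<tau>" for n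
    proof (rule AE_I2)
      fix \<tau> :: real
      show "norm (indicat_real {0<..} \<tau> *\<^sub>R (F (n + n0) \<tau> / \<tau> powr p)) \<le> indicat_real {0<..} \<tau> *\<^sub>R ?w \<tau>"
      proof (cases "\<tau> > 0")
        case True
        then show ?thesis
          using divide_right_mono[OF bound[of "n + n0" \<tau>], of "\<tau> powr p"] by simp
      qed simp
    qed
  qed (use lim' in simp)
qed


section \<open>Gaussian measures in coordinates\<close>

text \<open>
  The heat kernel at time \<open>\<tau>\<close> on \<open>\<real>\<^sup>I\<close>, centred at \<open>m\<close>, as a probability measure: for the equation
  \<open>\<partial>\<^sub>\<tau> U = \<Delta> U\<close>, without a factor \<open>1 / 2\<close>, each coordinate has variance \<open>2 \<tau>\<close>. The product form makes
  the coordinates independent by construction.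
\<close>

definition gauss :: "'i set \<Rightarrow> ('i \<Rightarrow> real) \<Rightarrow> real \<Rightarrow> ('i \<Rightarrow> real) measure" where
  "gauss I m \<tau> = (\<Pi>\<^sub>M i\<in>I. density lborel (normal_density (m i) (sqrt (2 * \<tau>))))"

lemma sets_gauss [measurable_cong]: "sets (gauss I m \<tau>) = sets (\<Pi>\<^sub>M i\<in>I. lborel)"
  unfolding gauss_def by (rule sets_PiM_cong) simp_all

lemma product_prob_space_normal:
  assumes "\<tau> > 0"
  shows "product_prob_space (\<lambda>i. density lborel (normal_density (m i) (sqrt (2 * \<tau>))))"
proof -
  have ps: "prob_space (density lborel (normal_density (m i) (sqrt (2 * \<tau>))))" for i
    by (rule prob_space_normal_density) (use assms in simp)
  show ?thesis
    by (intro product_prob_spaceI ps)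
qed

lemma prob_space_gauss: "\<tau> > 0 \<Longrightarrow> prob_space (gauss I m \<tau>)"
  unfolding gauss_def by (intro prob_space_PiM prob_space_normal_density) simp

text \<open>
  The product of the coordinate densities is the heat kernel, and both measures agree on boxes.
\<close>

lemma gauss_eq_density:
  fixes m :: "'i \<Rightarrow> real"
  assumes [simp]: "finite I" and \<tau>: "\<tau> > 0"
  shows "gauss I m \<tau> = density (\<Pi>\<^sub>M i\<in>I. lborel)
     (\<lambda>w. ennreal (1 / (4 * pi * \<tau>) powr (real (card I) / 2) * exp (- (\<Sum>i\<in>I. (m i - w i)\<^sup>2) / (4 * \<tau>))))"
proof -
  let ?N = "\<lambda>i. density lborel (normal_density (m i) (sqrt (2 * \<tau>)))"
  interpret L: product_sigma_finite "\<lambda>i::'i. lborel :: real measure"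
    by standard
  interpret P: product_prob_space ?N by (rule product_prob_space_normal[OF \<tau>])
  have dens: "1 / (4 * pi * \<tau>) powr (real (card I) / 2) * exp (- (\<Sum>i\<in>I. (m i - w i)\<^sup>2) / (4 * \<tau>))
      = (\<Prod>i\<in>I. normal_density (m i) (sqrt (2 * \<tau>)) (w i))" for w
  proof -
    have "(\<Prod>i\<in>I. normal_density (m i) (sqrt (2 * \<tau>)) (w i))
        = (1 / sqrt (4 * pi * \<tau>)) ^ card I * exp (\<Sum>i\<in>I. - (m i - w i)\<^sup>2 / (4 * \<tau>))"
      using \<tau> by (simp add: normal_density_def prod_dividef exp_sum power2_commute power_divide mult.assoc)
    also have "(1 / sqrt (4 * pi * \<tau>)) ^ card I = 1 / (4 * pi * \<tau>) powr (real (card I) / 2)"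
      using \<tau> by (simp add: power_divide powr_half_sqrt[symmetric] powr_powr flip: powr_realpow)
    finally show ?thesis by (simp add: sum_negf sum_divide_distrib)
  qed
  have "density (\<Pi>\<^sub>M i\<in>I. lborel) (\<lambda>w. ennreal (\<Prod>i\<in>I. normal_density (m i) (sqrt (2 * \<tau>)) (w i)))
     = (\<Pi>\<^sub>M i\<in>I. ?N i)"
  proof (rule P.PiM_eqI)
    show "sets (density (\<Pi>\<^sub>M i\<in>I. lborel) (\<lambda>w. ennreal (\<Prod>i\<in>I. normal_density (m i) (sqrt (2 * \<tau>)) (w i))))
      = sets (PiM I ?N)"
      by (simp, rule sets_PiM_cong) simp_all
  next
    fix A :: "'i \<Rightarrow> real set" assume A: "\<And>i. i \<in> I \<Longrightarrow> A i \<in> sets (?N i)"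
    then have A': "\<And>i. i \<in> I \<Longrightarrow> A i \<in> sets borel" by simp
    have "emeasure (density (\<Pi>\<^sub>M i\<in>I. lborel) (\<lambda>w. ennreal (\<Prod>i\<in>I. normal_density (m i) (sqrt (2 * \<tau>)) (w i)))) (Pi\<^sub>E I A)
      = (\<integral>\<^sup>+w. ennreal (\<Prod>i\<in>I. normal_density (m i) (sqrt (2 * \<tau>)) (w i)) * indicator (Pi\<^sub>E I A) w \<partial>(\<Pi>\<^sub>M i\<in>I. lborel))"
      using A' by (intro emeasure_density) (auto intro!: sets_PiM_I_finite)
    also have "\<dots> = (\<integral>\<^sup>+w. (\<Prod>i\<in>I. ennreal (normal_density (m i) (sqrt (2 * \<tau>)) (w i)) * indicator (A i) (w i)) \<partial>(\<Pi>\<^sub>M i\<in>I. lborel))"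
      by (intro nn_integral_cong)
        (auto simp: prod_ennreal prod.distrib indicator_def space_PiM PiE_iff prod_zero_iff)
    also have "\<dots> = (\<Prod>i\<in>I. \<integral>\<^sup>+w. ennreal (normal_density (m i) (sqrt (2 * \<tau>)) w) * indicator (A i) w \<partial>lborel)"
      using A' by (intro L.product_nn_integral_prod) auto
    also have "\<dots> = (\<Prod>i\<in>I. emeasure (?N i) (A i))"
      using A' by (intro prod.cong refl) (simp add: emeasure_density)
    finally show "emeasure (density (\<Pi>\<^sub>M i\<in>I. lborel) (\<lambda>w. ennreal (\<Prod>i\<in>I. normal_density (m i) (sqrt (2 * \<tau>)) (w i)))) (Pi\<^sub>E I A)
      = (\<Prod>i\<in>I. emeasure (?N i) (A i))" .
  qed simp
  then show ?thesis unfolding gauss_def dens by simp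
qed

text \<open>
  Completing the square: up to a constant, \<open>exp (- l * w\<^sup>2)\<close> times the normal density with mean \<open>a\<close> and
  variance \<open>2 \<tau>\<close> is the normal density with mean \<open>a / q\<close> and variance \<open>2 \<tau> / q\<close>,
  where \<open>q = 1 + 4 l \<tau>\<close>.
\<close>

lemma normal_laplace:
  assumes \<tau>: "\<tau> > 0" and lnn: "l \<ge> 0"
  shows "(\<integral>w. exp (- l * w\<^sup>2) \<partial>density lborel (normal_density a (sqrt (2 * \<tau>))))
       = exp (- l * a\<^sup>2 / (1 + 4 * l * \<tau>)) / sqrt (1 + 4 * l * \<tau>)"
proof -
  define q where "q = 1 + 4 * l * \<tau>"
  have q: "q > 0" using \<tau> lnn by (simp add: q_def add_pos_nonneg)
  have eq: "normal_density a (sqrt (2 * \<tau>)) w * exp (- l * w\<^sup>2)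
     = exp (- l * a\<^sup>2 / q) / sqrt q * normal_density (a / q) (sqrt (2 * \<tau> / q)) w" for w
  proof -
    have e: "- (w - a)\<^sup>2 / (4 * \<tau>) + - l * w\<^sup>2 = - l * a\<^sup>2 / q + - (w - a / q)\<^sup>2 / (4 * \<tau> / q)"
    proof -
      have "(- (w - a)\<^sup>2 / (4 * \<tau>) + - l * w\<^sup>2) * (4 * \<tau> * q) = (- l * a\<^sup>2 / q + - (w - a / q)\<^sup>2 / (4 * \<tau> / q)) * (4 * \<tau> * q)"
        using \<tau> q unfolding power2_eq_square
        by (simp add: field_simps) (simp add: q_def algebra_simps)
      then show ?thesis using \<tau> q by (simp only: mult_cancel_right) simp
    qed
    have s: "sqrt (4 * pi * \<tau>) = sqrt q * sqrt (4 * pi * \<tau> / q)"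
      using q by (simp flip: real_sqrt_mult)
    show ?thesis
      using \<tau> q e s unfolding normal_density_def
      by (simp add: exp_add[symmetric] mult_exp_exp mult.assoc)
  qed
  have "(\<integral>w. exp (- l * w\<^sup>2) \<partial>density lborel (normal_density a (sqrt (2 * \<tau>))))
     = (\<integral>w. normal_density a (sqrt (2 * \<tau>)) w * exp (- l * w\<^sup>2) \<partial>lborel)"
    by (subst integral_density) auto
  also have "\<dots> = exp (- l * a\<^sup>2 / q) / sqrt q"
    unfolding eq using \<tau> q by simp
  finally show ?thesis by (simp add: q_def)
qed

text \<open>
  By independence this is a product of one-dimensional transforms. The right-hand side depends on
  \<open>m\<close> through its Euclidean norm alone, which is the source of radiality, and its denominator grows fast
  enough in \<open>card I\<close> to give the large-time decay.
\<close>

lemma gauss_laplace: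
  assumes [simp]: "finite I" and \<tau>: "\<tau> > 0" and lnn: "l \<ge> 0"
  shows "(\<integral>w. exp (- l * (\<Sum>i\<in>I. (w i)\<^sup>2)) \<partial>gauss I m \<tau>)
       = exp (- l * (\<Sum>i\<in>I. (m i)\<^sup>2) / (1 + 4 * l * \<tau>)) / sqrt (1 + 4 * l * \<tau>) ^ card I"
proof -
  interpret P: product_prob_space "\<lambda>i. density lborel (normal_density (m i) (sqrt (2 * \<tau>)))"
    by (rule product_prob_space_normal[OF \<tau>])
  have int: "integrable (density lborel (normal_density (m i) (sqrt (2 * \<tau>)))) (\<lambda>w. exp (- l * w\<^sup>2))" for i
    by (rule P.M.integrable_const_bound[where B=1]) (use lnn in auto)
  have "(\<integral>w. exp (- l * (\<Sum>i\<in>I. (w i)\<^sup>2)) \<partial>gauss I m \<tau>)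
     = (\<integral>w. (\<Prod>i\<in>I. exp (- l * (w i)\<^sup>2)) \<partial>gauss I m \<tau>)"
    by (simp add: exp_sum[symmetric] sum_distrib_left sum_negf)
  also have "\<dots> = (\<Prod>i\<in>I. exp (- l * (m i)\<^sup>2 / (1 + 4 * l * \<tau>)) / sqrt (1 + 4 * l * \<tau>))"
    unfolding gauss_def using int by (subst P.product_integral_prod) (simp_all only: normal_laplace[OF \<tau> lnn], simp)
  also have "\<dots> = exp (- l * (\<Sum>i\<in>I. (m i)\<^sup>2) / (1 + 4 * l * \<tau>)) / sqrt (1 + 4 * l * \<tau>) ^ card I"
    by (simp add: prod_dividef exp_sum[symmetric] sum_distrib_left sum_divide_distrib sum_negf)
  finally show ?thesis .
qed

lemma normal_centred_moments:
  assumes \<tau>: "\<tau> > 0"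
  shows "has_bochner_integral (density lborel (normal_density a (sqrt (2 * \<tau>)))) (\<lambda>w. w - a) 0"
    and "has_bochner_integral (density lborel (normal_density a (sqrt (2 * \<tau>)))) (\<lambda>w. (w - a)\<^sup>2) (2 * \<tau>)"
    and "has_bochner_integral (density lborel (normal_density a (sqrt (2 * \<tau>)))) (\<lambda>w. (w - a)^3) 0"
    and "has_bochner_integral (density lborel (normal_density a (sqrt (2 * \<tau>)))) (\<lambda>w. (w - a)^4) (12 * \<tau>\<^sup>2)"
proof -
  have dens: "has_bochner_integral (density lborel (normal_density a (sqrt (2 * \<tau>)))) f c"
    if "has_bochner_integral lborel (\<lambda>w. normal_density a (sqrt (2 * \<tau>)) w * f w) c"
      and "f \<in> borel_measurable borel" for f :: "real \<Rightarrow> real" and c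
    by (rule has_bochner_integral_density) (use that in auto)
  have s: "0 < sqrt (2 * \<tau>)" using \<tau> by simp
  show "has_bochner_integral (density lborel (normal_density a (sqrt (2 * \<tau>)))) (\<lambda>w. w - a) 0"
    using normal_moment_odd[OF s, of a 0] by (intro dens) simp_all
  show "has_bochner_integral (density lborel (normal_density a (sqrt (2 * \<tau>)))) (\<lambda>w. (w - a)\<^sup>2) (2 * \<tau>)"
    using normal_moment_even[OF s, of a 1] \<tau> by (intro dens) simp_all
  show "has_bochner_integral (density lborel (normal_density a (sqrt (2 * \<tau>)))) (\<lambda>w. (w - a)^3) 0"
    using normal_moment_odd[OF s, of a 1] by (intro dens) simp_all
  show "has_bochner_integral (density lborel (normal_density a (sqrt (2 * \<tau>)))) (\<lambda>w. (w - a)^4) (12 * \<tau>\<^sup>2)"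
    using normal_moment_even[OF s, of a 2] \<tau> 
    by (intro dens) (simp_all add: fact_numeral power2_eq_square)
qed

lemma gauss_component:
  fixes f :: "real \<Rightarrow> real"
  assumes "finite I" and \<tau>: "\<tau> > 0" and i: "i \<in> I"
    and f: "has_bochner_integral (density lborel (normal_density (m i) (sqrt (2 * \<tau>)))) f c"
  shows "has_bochner_integral (gauss I m \<tau>) (\<lambda>w. f (w i)) c"
proof -
  interpret P: product_prob_space "\<lambda>i. density lborel (normal_density (m i) (sqrt (2 * \<tau>)))"
    by (rule product_prob_space_normal[OF \<tau>])
  have "has_bochner_integral (distr (PiM I (\<lambda>i. density lborel (normal_density (m i) (sqrt (2 * \<tau>)))))
      (density lborel (normal_density (m i) (sqrt (2 * \<tau>)))) (\<lambda>w. w i)) f c"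
    unfolding P.PiM_component[OF i] by (rule f)
  moreover have "f \<in> borel_measurable borel"
    using f by (auto simp: has_bochner_integral_iff dest: borel_measurable_integrable)
  moreover have "(\<lambda>w. w i) \<in> PiM I (\<lambda>i. density lborel (normal_density (m i) (sqrt (2 * \<tau>))))
      \<rightarrow>\<^sub>M density lborel (normal_density (m i) (sqrt (2 * \<tau>)))"
    using i by (rule measurable_component_singleton)
  ultimately show ?thesis
    unfolding gauss_def has_bochner_integral_iff
    by (simp add: integrable_distr_eq integral_distr)
qed

text \<open>
  The product \<open>f (w i) * g (w j)\<close> is a product over all coordinates with the constant factor \<open>1\<close>
  away from \<open>i\<close> and \<open>j\<close>, so its expectation factorizes.
\<close>

lemma gauss_uncorrelated:
  fixes f g :: "real \<Rightarrow> real"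
  assumes I: "finite I" and \<tau>: "\<tau> > 0" and ij: "i \<in> I" "j \<in> I" "i \<noteq> j"
    and f: "has_bochner_integral (density lborel (normal_density (m i) (sqrt (2 * \<tau>)))) f 0"
    and g: "has_bochner_integral (density lborel (normal_density (m j) (sqrt (2 * \<tau>)))) g 0"
  shows "has_bochner_integral (gauss I m \<tau>) (\<lambda>w. f (w i) * g (w j)) 0"
proof -
  interpret P: product_prob_space "\<lambda>i. density lborel (normal_density (m i) (sqrt (2 * \<tau>)))"
    by (rule product_prob_space_normal[OF \<tau>])
  define h where "h = (\<lambda>k. if k = i then f else if k = j then g else (\<lambda>_. 1))"
  have int: "integrable (density lborel (normal_density (m k) (sqrt (2 * \<tau>)))) (h k)" for k
    using f g by (simp add: h_def has_bochner_integral_iff)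
  have prod_h: "(\<Prod>k\<in>I. h k (w k)) = f (w i) * g (w j)" for w
  proof -
    have "(\<Prod>k\<in>I. h k (w k)) = (\<Prod>k\<in>{i, j}. h k (w k))"
      using I ij by (intro prod.mono_neutral_right) (auto simp: h_def)
    then show ?thesis using ij by (simp add: h_def)
  qed
  have "(\<Prod>k\<in>I. integral\<^sup>L (density lborel (normal_density (m k) (sqrt (2 * \<tau>)))) (h k)) = 0"
    using I ij(1) f by (intro prod_zero) (auto simp: h_def has_bochner_integral_iff intro!: bexI[of _ i])
  then show ?thesis
    unfolding has_bochner_integral_iff gauss_def
    using P.product_integrable_prod[OF I, of h] P.product_integral_prod[OF I, of h] int
    unfolding prod_h by simp
qed

lemma gauss_variance_sum:
  fixes f :: "'i \<Rightarrow> real \<Rightarrow> real"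
  assumes I: "finite I" and \<tau>: "\<tau> > 0"
    and mean: "\<And>i. i \<in> I \<Longrightarrow> has_bochner_integral (density lborel (normal_density (m i) (sqrt (2 * \<tau>)))) (f i) 0"
    and var: "\<And>i. i \<in> I \<Longrightarrow> has_bochner_integral (density lborel (normal_density (m i) (sqrt (2 * \<tau>)))) (\<lambda>w. (f i w)\<^sup>2) (V i)"
  shows "has_bochner_integral (gauss I m \<tau>) (\<lambda>w. (\<Sum>i\<in>I. f i (w i))\<^sup>2) (\<Sum>i\<in>I. V i)"
proof -
  have "has_bochner_integral (gauss I m \<tau>) (\<lambda>w. f i (w i) * f j (w j)) (if i = j then V i else 0)"
    if "i \<in> I" "j \<in> I" for i j
    using gauss_uncorrelated[where f="f i" and g="f j", OF I \<tau> that] mean that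
      gauss_component[where m=m and f="\<lambda>w. (f i w)\<^sup>2", OF I \<tau> that(1) var[OF that(1)]]
    by (auto simp: power2_eq_square)
  then have "has_bochner_integral (gauss I m \<tau>) (\<lambda>w. \<Sum>i\<in>I. \<Sum>j\<in>I. f i (w i) * f j (w j))
      (\<Sum>i\<in>I. \<Sum>j\<in>I. if i = j then V i else 0)"
    by (intro has_bochner_integral_sum) auto
  moreover have "(\<Sum>i\<in>I. \<Sum>j\<in>I. if i = j then V i else 0) = (\<Sum>i\<in>I. V i)"
    using I by simp
  ultimately show ?thesis by (simp add: power2_eq_square sum_product)
qed

section \<open>The heat semigroups as Gaussian expectations\<close>

text \<open>
  The same kernel on an abstract Euclidean space. The density is the form in which it enters the heat
  semigroups; \<open>gauss_on_eq_distr\<close> transfers the moments from the product measure over an orthonormal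
  basis.
\<close>

definition gauss_on :: "'a::euclidean_space \<Rightarrow> real \<Rightarrow> 'a measure" where
  "gauss_on x \<tau> = density lborel
     (\<lambda>x'. ennreal (1 / (4 * pi * \<tau>) powr (real DIM('a) / 2) * exp (- (norm (x - x'))\<^sup>2 / (4 * \<tau>))))"

lemma sets_gauss_on [measurable_cong]: "sets (gauss_on x \<tau>) = sets borel"
  by (simp add: gauss_on_def)

lemma norm_square_eq_sum_Basis: "(norm (z::'a::euclidean_space))\<^sup>2 = (\<Sum>b\<in>Basis. (z \<bullet> b)\<^sup>2)"
  unfolding power2_norm_eq_inner by (subst euclidean_inner) (simp add: power2_eq_square)

lemma gauss_on_eq_distr:
  fixes x :: "'a::euclidean_space"
  assumes \<tau>: "\<tau> > 0"
  shows "gauss_on x \<tau> = distr (gauss Basis (\<lambda>b. x \<bullet> b) \<tau>) borel (\<lambda>w. \<Sum>b\<in>Basis. w b *\<^sub>R b)"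
proof -
  have norm_eq: "(norm (x - (\<Sum>b\<in>Basis. w b *\<^sub>R b)))\<^sup>2 = (\<Sum>b\<in>Basis. (x \<bullet> b - w b)\<^sup>2)" for w
    by (simp add: norm_square_eq_sum_Basis inner_diff_left)
  show ?thesis
    unfolding gauss_on_def gauss_eq_density[OF finite_Basis \<tau>]
    by (subst lborel_eq, subst density_distr) (simp_all add: norm_eq)
qed

lemma prob_space_gauss_on: "\<tau> > 0 \<Longrightarrow> prob_space (gauss_on x \<tau>)"
  unfolding gauss_on_eq_distr
  by (rule prob_space.prob_space_distr[OF prob_space_gauss]) measurable

lemma gauss_on_coordinate:
  fixes x :: "'a::euclidean_space" and f :: "real \<Rightarrow> real"
  assumes \<tau>: "\<tau> > 0" and b: "b \<in> Basis"
    and f: "has_bochner_integral (density lborel (normal_density (x \<bullet> b) (sqrt (2 * \<tau>)))) f c"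
  shows "has_bochner_integral (gauss_on x \<tau>) (\<lambda>x'. f (x' \<bullet> b)) c"
proof -
  have fm [measurable]: "f \<in> borel_measurable borel"
    using f by (auto simp: has_bochner_integral_iff dest: borel_measurable_integrable)
  have "has_bochner_integral (gauss Basis (\<lambda>b. x \<bullet> b) \<tau>) (\<lambda>w. f (w b)) c"
    by (rule gauss_component) (use \<tau> b f in auto)
  then show ?thesis
    unfolding gauss_on_eq_distr[OF \<tau>]
    by (intro has_bochner_integral_distr) (simp_all add: b)
qed

lemma gauss_on_mean:
  fixes x :: "'a::euclidean_space"
  assumes \<tau>: "\<tau> > 0" and D: "linear (D :: 'a \<Rightarrow> real)"
  shows "has_bochner_integral (gauss_on x \<tau>) (\<lambda>x'. D (x' - x)) 0"
proof -
  have "has_bochner_integral (gauss_on x \<tau>) (\<lambda>x'. \<Sum>b\<in>Basis. (x' \<bullet> b - x \<bullet> b) * D b) (\<Sum>b\<in>(Basis::'a set). 0 * D b)"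
    by (intro has_bochner_integral_sum has_bochner_integral_mult_left
        gauss_on_coordinate[where f="\<lambda>w. w - x \<bullet> _"] \<tau> normal_centred_moments(1)) auto
  moreover have "D (x' - x) = (\<Sum>b\<in>Basis. (x' \<bullet> b - x \<bullet> b) * D b)" for x'
  proof -
    have "D (x' - x) = D (\<Sum>b\<in>Basis. ((x' - x) \<bullet> b) *\<^sub>R b)" by (simp only: euclidean_representation)
    also have "\<dots> = (\<Sum>b\<in>Basis. ((x' - x) \<bullet> b) *\<^sub>R D b)"
      by (simp only: linear_sum[OF D] linear_scale[OF D])
    finally show ?thesis by (simp add: inner_diff_left)
  qed
  ultimately show ?thesis by simp
qed

lemma gauss_on_variance:
  fixes x :: "'a::euclidean_space"
  assumes \<tau>: "\<tau> > 0"
  shows "has_bochner_integral (gauss_on x \<tau>) (\<lambda>x'. (norm (x' - x))\<^sup>2) (2 * \<tau> * DIM('a))"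
proof -
  have "has_bochner_integral (gauss_on x \<tau>) (\<lambda>x'. \<Sum>b\<in>Basis. (x' \<bullet> b - x \<bullet> b)\<^sup>2) (\<Sum>b\<in>(Basis::'a set). 2 * \<tau>)"
    by (intro has_bochner_integral_sum
        gauss_on_coordinate[where f="\<lambda>w. (w - x \<bullet> _)\<^sup>2"] \<tau> normal_centred_moments(2)) auto
  moreover have "(norm (x' - x))\<^sup>2 = (\<Sum>b\<in>Basis. (x' \<bullet> b - x \<bullet> b)\<^sup>2)" for x'
    by (simp add: norm_square_eq_sum_Basis inner_diff_left)
  ultimately show ?thesis by (simp add: mult_ac)
qed

lemma L2_set_square: "(L2_set f I)\<^sup>2 = (\<Sum>i\<in>I. (f i)\<^sup>2)"
  by (simp add: L2_set_def sum_nonneg)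

text \<open>
  The weight in the definition of \<open>heat\<close> is the product of the two Gaussian densities, and the order of
  integration is chosen so that the \<open>y\<close> variable, where the dimension grows, is inside.
\<close>

lemma heat_eq_iterated_gauss:
  fixes f :: "'a::euclidean_space \<times> (nat \<Rightarrow> real) \<Rightarrow> real"
  assumes \<tau>: "\<tau> > 0" and f [measurable]: "f \<in> borel_measurable (lebesgue_prod N)"
    and bound: "\<And>z. \<bar>f z\<bar> \<le> C"
  shows "heat N f (x, y) \<tau> = (\<integral>x'. (\<integral>y'. f (x', y') \<partial>gauss {..<N} y \<tau>) \<partial>gauss_on x \<tau>)"
proof -
  interpret X: prob_space "gauss_on x \<tau>" by (rule prob_space_gauss_on[OF \<tau>])
  interpret Y: prob_space "gauss {..<N} y \<tau>" by (rule prob_space_gauss[OF \<tau>])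
  interpret XY: pair_prob_space "gauss_on x \<tau>" "gauss {..<N} y \<tau>" ..
  interpret L: finite_product_sigma_finite "\<lambda>i::nat. lborel :: real measure" "{..<N}"
    by standard simp
  define k where "k = (\<lambda>x'. 1 / (4 * pi * \<tau>) powr (real DIM('a) / 2) * exp (- (norm (x - x'))\<^sup>2 / (4 * \<tau>)))"
  define g where "g = (\<lambda>w. 1 / (4 * pi * \<tau>) powr (real N / 2) * exp (- (\<Sum>i<N. (y i - w i)\<^sup>2) / (4 * \<tau>)))"
  have [measurable]: "k \<in> borel_measurable borel" "g \<in> borel_measurable (\<Pi>\<^sub>M i\<in>{..<N}. lborel)"
    unfolding k_def g_def by measurable
  have nn: "k x' \<ge> 0" "g w \<ge> 0" for x' w by (simp_all add: k_def g_def)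
  have gx: "gauss_on x \<tau> = density lborel (\<lambda>x'. ennreal (k x'))"
    by (simp add: gauss_on_def k_def)
  have gy: "gauss {..<N} y \<tau> = density (\<Pi>\<^sub>M i\<in>{..<N}. lborel) (\<lambda>w. ennreal (g w))"
    using gauss_eq_density[of "{..<N}" \<tau> y] \<tau> by (simp add: g_def)
  have pair: "gauss_on x \<tau> \<Otimes>\<^sub>M gauss {..<N} y \<tau> = density (lebesgue_prod N) (\<lambda>z. ennreal (k (fst z) * g (snd z)))"
  proof -
    have "gauss_on x \<tau> \<Otimes>\<^sub>M gauss {..<N} y \<tau>
       = density (lborel \<Otimes>\<^sub>M (\<Pi>\<^sub>M i\<in>{..<N}. lborel)) (\<lambda>(x', w). ennreal (k x') * ennreal (g w))"
      unfolding gx gy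
      by (rule pair_measure_density)
        (use Y.sigma_finite_measure_axioms L.sigma_finite_measure_axioms in \<open>simp_all add: gy\<close>)
    then show ?thesis by (simp add: ennreal_mult nn lebesgue_prod_def split_beta')
  qed
  have "(\<integral>x'. (\<integral>y'. f (x', y') \<partial>gauss {..<N} y \<tau>) \<partial>gauss_on x \<tau>)
     = integral\<^sup>L (gauss_on x \<tau> \<Otimes>\<^sub>M gauss {..<N} y \<tau>) f"
  proof (rule XY.integral_fst')
    have "f \<in> borel_measurable (gauss_on x \<tau> \<Otimes>\<^sub>M gauss {..<N} y \<tau>)"
      using f unfolding pair by simp
    then show "integrable (gauss_on x \<tau> \<Otimes>\<^sub>M gauss {..<N} y \<tau>) f"
      by (intro XY.P.integrable_const_bound[where B=C]) (use bound in auto)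
  qed
  also have "\<dots> = (\<integral>(x', w). k x' * g w * f (x', w) \<partial>lebesgue_prod N)"
    unfolding pair
    using f by (subst integral_density) (auto simp: nn lebesgue_prod_def split_beta')
  also have "\<dots> = heat N f (x, y) \<tau>"
  proof -
    have "k x' * g w = 1 / (4 * pi * \<tau>) powr (real (DIM('a) + N) / 2) *
       exp (- (norm (x - x') ^ 2 + L2_set (\<lambda>i. y i - w i) {..<N} ^ 2) / (4 * \<tau>))" for x' w
    proof -
      have "(4 * pi * \<tau>) powr (real (DIM('a) + N) / 2) = (4 * pi * \<tau>) powr (real DIM('a) / 2) * (4 * pi * \<tau>) powr (real N / 2)"
        by (simp add: powr_add[symmetric] add_divide_distrib)
      then show ?thesis
        by (simp add: k_def g_def L2_set_square exp_add[symmetric] mult_exp_exp add_divide_distrib diff_divide_distrib)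
    qed
    then show ?thesis
      unfolding heat_def by (simp add: mult.assoc split_beta')
  qed
  finally show ?thesis by simp
qed

text \<open>
  The reflection \<open>x' \<mapsto> x - x'\<close>, which preserves Lebesgue measure, turns the convolution into an
  expectation centred at \<open>x\<close>.
\<close>

lemma backward_heat_eq_gauss:
  fixes v :: "'a::euclidean_space \<times> real \<Rightarrow> real"
  assumes \<tau>: "\<tau> > 0" and v [measurable]: "v \<in> borel_measurable borel"
  shows "backward_heat v (x, t) \<tau> = (\<integral>x'. v (x', t + \<tau>) \<partial>gauss_on x \<tau>)"
proof -
  have v' [measurable]: "(\<lambda>x'. v (x', t + \<tau>)) \<in> borel_measurable borel"
  proof -
    have "(\<lambda>x'. (x', t + \<tau>)) \<in> borel \<rightarrow>\<^sub>M (borel :: ('a \<times> real) measure)"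
      by (intro borel_measurable_continuous_onI continuous_intros)
    then show ?thesis by (rule measurable_compose) simp
  qed
  let ?c = "1 / (4 * pi * \<tau>) powr (real DIM('a) / 2)"
  have refl: "(lborel :: 'a measure) = distr lborel borel (\<lambda>x'. x - x')"
    using lborel_affine[of "-1" x] by (simp add: density_1)
  have "(\<integral>x'. v (x', t + \<tau>) \<partial>gauss_on x \<tau>)
      = (\<integral>x'. ?c * exp (- (norm (x - x'))\<^sup>2 / (4 * \<tau>)) * v (x', t + \<tau>) \<partial>lborel)"
    unfolding gauss_on_def by (subst integral_density) simp_all
  also have "\<dots> = (\<integral>x'. ?c * exp (- (norm x')\<^sup>2 / (4 * \<tau>)) * v (x - x', t + \<tau>) \<partial>lborel)"
    by (subst refl, subst integral_distr) simp_all
  also have "\<dots> = backward_heat v (x, t) \<tau>"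
    unfolding backward_heat_def by (simp add: mult.assoc)
  finally show ?thesis by simp
qed

lemma borel_measurable_heat:
  fixes f :: "'a::euclidean_space \<times> (nat \<Rightarrow> real) \<Rightarrow> real"
  assumes f [measurable]: "f \<in> borel_measurable (lebesgue_prod N)"
  shows "(\<lambda>\<tau>. heat N f z \<tau>) \<in> borel_measurable borel"
proof -
  interpret L: finite_product_sigma_finite "\<lambda>i::nat. lborel :: real measure" "{..<N}"
    by standard simp
  interpret P: pair_sigma_finite "lborel :: 'a measure" "\<Pi>\<^sub>M i\<in>{..<N}. lborel :: real measure" ..
  have f' [measurable]: "f \<in> borel_measurable (borel \<Otimes>\<^sub>M (\<Pi>\<^sub>M i\<in>{..<N}. lborel))"
    using f by (simp add: lebesgue_prod_def cong: measurable_cong_sets)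
  obtain x y where z: "z = (x, y)" by (cases z)
  show ?thesis
    unfolding z heat_def prod.case lebesgue_prod_def L2_set_square split_beta'
    by measurable
qed

section \<open>Heat flow of radial lifts\<close>

text \<open>
  The first-order term \<open>l\<close> is centred and disappears in the mean; only the quadratic remainder
  survives. For \<open>q\<close> of mean \<open>O (\<tau>)\<close> or \<open>O (1 / N)\<close> this improves the order of a mere Lipschitz estimate
  from one half to one.
\<close>

lemma (in prob_space) expectation_second_order_estimate:
  fixes f l q :: "'a \<Rightarrow> real"
  assumes f: "integrable M f" and l: "has_bochner_integral M l 0" and q: "has_bochner_integral M q V"
    and taylor: "\<And>w. \<bar>f w - c - l w\<bar> \<le> K * q w"
  shows "\<bar>expectation f - c\<bar> \<le> K * V"
proof -
  have int: "integrable M l" "integrable M q" "expectation l = 0" "expectation q = V"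
    using l q by (auto simp: has_bochner_integral_iff)
  have "expectation f - c = expectation (\<lambda>w. f w - c - l w)"
    using f int by (simp add: prob_space)
  also have "\<bar>\<dots>\<bar> \<le> expectation (\<lambda>w. \<bar>f w - c - l w\<bar>)" by (rule integral_abs_bound)
  also have "\<dots> \<le> expectation (\<lambda>w. K * q w)"
    using f int taylor by (intro integral_mono) auto
  also have "\<dots> = K * V" using int by simp
  finally show ?thesis .
qed

lemma (in prob_space) abs_expectation_le:
  fixes f :: "'a \<Rightarrow> real"
  assumes f [measurable]: "f \<in> borel_measurable M" and bound: "\<And>w. \<bar>f w\<bar> \<le> B"
  shows "\<bar>expectation f\<bar> \<le> B"
proof -
  have int: "integrable M f" by (rule integrable_const_bound[where B=B]) (use bound in auto)
  have "\<bar>expectation f\<bar> \<le> expectation (\<lambda>w. \<bar>f w\<bar>)" by (rule integral_abs_bound)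
  also have "\<dots> \<le> B" by (rule integral_le_const) (use int bound in auto)
  finally show ?thesis .
qed

abbreviation lifted_time :: "nat \<Rightarrow> (nat \<Rightarrow> real) \<Rightarrow> real" where
  "lifted_time N w \<equiv> (\<Sum>i<N. (w i)\<^sup>2) / (2 * real N)"

lemma radial_lift_eq: "radial_lift N v (x, w) = v (x, lifted_time N w)"
  by (simp add: radial_lift_def L2_set_square)

lemma measurable_lifted_time [measurable]: "lifted_time N \<in> borel_measurable (\<Pi>\<^sub>M i\<in>{..<N}. lborel)"
  by measurable

lemma measurable_radial_lift:
  fixes v :: "'a::euclidean_space \<times> real \<Rightarrow> real"
  assumes v: "continuous_on UNIV v"
  shows "radial_lift N v \<in> borel_measurable (borel \<Otimes>\<^sub>M (\<Pi>\<^sub>M i\<in>{..<N}. lborel))"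
proof -
  have [measurable]: "v \<in> borel_measurable (borel \<Otimes>\<^sub>M borel)"
    unfolding borel_prod using v by (rule borel_measurable_continuous_onI)
  have "radial_lift N v = (\<lambda>z. v (fst z, lifted_time N (snd z)))"
    by (auto simp: radial_lift_eq)
  then show ?thesis by simp
qed

lemma measurable_slice:
  fixes v :: "'a::euclidean_space \<times> real \<Rightarrow> real"
  assumes v: "continuous_on UNIV v"
  shows "(\<lambda>x. v (x, r)) \<in> borel_measurable borel" "(\<lambda>r. v (x, r)) \<in> borel_measurable borel"
  by (auto intro!: borel_measurable_continuous_onI continuous_on_compose2[OF v] continuous_intros)

lemma heat_radial_lift:
  fixes v :: "'a::euclidean_space \<times> real \<Rightarrow> real"
  assumes \<tau>: "\<tau> > 0" and v: "continuous_on UNIV v" and bound: "\<And>z. \<bar>v z\<bar> \<le> C"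
  shows "heat N (radial_lift N v) (x, y) \<tau> = (\<integral>x'. (\<integral>w. v (x', lifted_time N w) \<partial>gauss {..<N} y \<tau>) \<partial>gauss_on x \<tau>)"
proof -
  have "radial_lift N v \<in> borel_measurable (lebesgue_prod N)"
    using measurable_radial_lift[OF v, of N] by (simp add: lebesgue_prod_def cong: measurable_cong_sets)
  then show ?thesis
    by (subst heat_eq_iterated_gauss[OF \<tau>, of _ _ C])
      (use bound in \<open>auto simp: radial_lift_def L2_set_square\<close>)
qed

lemma measurable_inner_expectation:
  fixes v :: "'a::euclidean_space \<times> real \<Rightarrow> real"
  assumes \<tau>: "\<tau> > 0" and v: "continuous_on UNIV v"
  shows "(\<lambda>x'. \<integral>w. v (x', lifted_time N w) \<partial>gauss {..<N} y \<tau>) \<in> borel_measurable borel"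
proof -
  interpret Y: prob_space "gauss {..<N} y \<tau>" by (rule prob_space_gauss[OF \<tau>])
  have "(\<lambda>(x', w). v (x', lifted_time N w)) = radial_lift N v"
    by (auto simp: radial_lift_eq)
  then have "(\<lambda>(x', w). v (x', lifted_time N w)) \<in> borel_measurable (borel \<Otimes>\<^sub>M gauss {..<N} y \<tau>)"
    using measurable_radial_lift[OF v, of N] by (simp cong: measurable_cong_sets)
  then show ?thesis by (rule Y.borel_measurable_lebesgue_integral)
qed

lemma measurable_radial_slice:
  fixes v :: "'a::euclidean_space \<times> real \<Rightarrow> real"
  assumes v: "continuous_on UNIV v"
  shows "(\<lambda>w. v (x, lifted_time N w)) \<in> borel_measurable (gauss {..<N} y \<tau>)"
  by (rule measurable_compose[OF _ measurable_slice(2)[OF v]]) measurable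

lemma abs_heat_radial_lift_le:
  fixes v :: "'a::euclidean_space \<times> real \<Rightarrow> real"
  assumes \<tau>: "\<tau> > 0" and v: "continuous_on UNIV v" and bound: "\<And>z. \<bar>v z\<bar> \<le> C"
    and inner: "\<And>x'. \<bar>\<integral>w. v (x', lifted_time N w) \<partial>gauss {..<N} y \<tau>\<bar> \<le> B"
  shows "\<bar>heat N (radial_lift N v) (x, y) \<tau>\<bar> \<le> B"
proof -
  interpret X: prob_space "gauss_on x \<tau>" by (rule prob_space_gauss_on[OF \<tau>])
  show ?thesis
    unfolding heat_radial_lift[OF \<tau> v bound]
    by (rule X.abs_expectation_le)
      (use measurable_inner_expectation[OF \<tau> v] inner in \<open>auto cong: measurable_cong_sets\<close>)
qed


text \<open>
  The decay hypothesis makes \<open>r \<mapsto> v (x', r / (2 N))\<close> vanish at infinity, so that its expectation is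
  determined by the Laplace transform of \<open>|w|\<^sup>2\<close>, which is the same for \<open>y\<close> and \<open>y'\<close>.
\<close>

lemma heat_radial_lift_rotation_invariant:
  fixes v :: "'a::euclidean_space \<times> real \<Rightarrow> real"
  assumes \<tau>: "\<tau> > 0" and v: "continuous_on UNIV v" and bound: "\<And>z. \<bar>v z\<bar> \<le> C"
    and decay: "\<And>x r. \<bar>v (x, r)\<bar> * \<bar>r\<bar> \<le> C"
    and N: "N \<ge> 1" and y: "(\<Sum>i<N. (y i)\<^sup>2) = (\<Sum>i<N. (y' i)\<^sup>2)"
  shows "heat N (radial_lift N v) (x, y) \<tau> = heat N (radial_lift N v) (x, y') \<tau>"
proof -
  have "(\<integral>w. v (x', lifted_time N w) \<partial>gauss {..<N} y \<tau>) = (\<integral>w. v (x', lifted_time N w) \<partial>gauss {..<N} y' \<tau>)" for x'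
  proof (rule laplace_transform_determines_expectation[where g="\<lambda>r. v (x', r / (2 * real N))"
        and X="\<lambda>w. \<Sum>i<N. (w i)\<^sup>2" and Y="\<lambda>w. \<Sum>i<N. (w i)\<^sup>2"])
    show "continuous_on UNIV (\<lambda>r. v (x', r / (2 * real N)))"
      using N by (intro continuous_on_compose2[OF v] continuous_intros) auto
    show "((\<lambda>r. v (x', r / (2 * real N))) \<longlongrightarrow> 0) at_top"
    proof (rule Lim_null_comparison)
      show "\<forall>\<^sub>F r in at_top. norm (v (x', r / (2 * real N))) \<le> C * (2 * real N) / r"
        using eventually_gt_at_top[of 0]
      proof eventually_elim
        fix r :: real assume "r > 0"
        then show "norm (v (x', r / (2 * real N))) \<le> C * (2 * real N) / r"
          using decay[of x' "r / (2 * real N)"] N by (simp add: field_simps)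
      qed
      show "((\<lambda>r. C * (2 * real N) / r) \<longlongrightarrow> 0) at_top" by real_asymp
    qed
    show "(\<integral>w. exp (- real n * (\<Sum>i<N. (w i)\<^sup>2)) \<partial>gauss {..<N} y \<tau>)
        = (\<integral>w. exp (- real n * (\<Sum>i<N. (w i)\<^sup>2)) \<partial>gauss {..<N} y' \<tau>)" for n
      by (subst (1 2) gauss_laplace) (use \<tau> y in auto)
  qed (use prob_space_gauss[OF \<tau>] in \<open>auto simp: sum_nonneg\<close>)
  then show ?thesis by (simp add: heat_radial_lift[OF \<tau> v bound])
qed


section \<open>Concentration of the lifted time\<close>

text \<open>
  Spreading the norm of \<open>y\<close> equally over its coordinates makes the lifted time an average of \<open>N\<close>
  identically distributed terms \<open>w\<^sub>i\<^sup>2 / 2\<close>. Writing \<open>w\<^sub>i = m + z\<close> with \<open>m\<^sup>2 = 2 t\<close>, the centred term is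
  \<open>z\<^sup>2 / 2 + m z - \<tau>\<close>, whose variance \<open>4 t \<tau> + 2 \<tau>\<^sup>2\<close> follows from the first four moments of \<open>z\<close>.
\<close>

lemma lifted_time_moments:
  assumes \<tau>: "\<tau> > 0" and t: "t \<ge> 0" and N: "N \<ge> 1" and y: "\<And>i. i < N \<Longrightarrow> y i = sqrt (2 * t)"
  shows "has_bochner_integral (gauss {..<N} y \<tau>) (\<lambda>w. lifted_time N w - (t + \<tau>)) 0"
    and "has_bochner_integral (gauss {..<N} y \<tau>) (\<lambda>w. (lifted_time N w - (t + \<tau>))\<^sup>2) ((4 * t * \<tau> + 2 * \<tau>\<^sup>2) / real N)"
proof -
  define m where "m = sqrt (2 * t)"
  have m2: "m\<^sup>2 = 2 * t" using t by (simp add: m_def)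
  let ?P = "density lborel (normal_density m (sqrt (2 * \<tau>)))"
  define c where "c = (\<lambda>w::real. w\<^sup>2 / 2 - (t + \<tau>))"
  interpret P: prob_space ?P by (rule prob_space_normal_density) (use \<tau> in simp)
  note mom = normal_centred_moments[OF \<tau>, of m]
  have one: "has_bochner_integral ?P (\<lambda>_. k) k" for k :: real
    using P.prob_space by (simp add: has_bochner_integral_iff)
  have c1: "c w = 1 / 2 * (w - m)\<^sup>2 + m * (w - m) - \<tau>" for w
    using m2 by (simp add: c_def power2_eq_square algebra_simps)
  have "has_bochner_integral ?P c (1 / 2 * (2 * \<tau>) + m * 0 - \<tau>)"
    unfolding c1[abs_def]
    by (intro has_bochner_integral_add has_bochner_integral_diff has_bochner_integral_mult_right mom one)
  then have c_mean: "has_bochner_integral ?P c 0" by simp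
  have c2: "(c w)\<^sup>2 = 1 / 4 * (w - m)^4 + m * (w - m)^3 + (2 * t - \<tau>) * (w - m)\<^sup>2 - (2 * m * \<tau>) * (w - m) + \<tau>\<^sup>2" for w
    unfolding c1 m2[symmetric] by (simp add: power2_eq_square power3_eq_cube power4_eq_xxxx field_simps)
  have "has_bochner_integral ?P (\<lambda>w. (c w)\<^sup>2) (1 / 4 * (12 * \<tau>\<^sup>2) + m * 0 + (2 * t - \<tau>) * (2 * \<tau>) - (2 * m * \<tau>) * 0 + \<tau>\<^sup>2)"
    unfolding c2
    by (intro has_bochner_integral_add has_bochner_integral_diff has_bochner_integral_mult_right mom one)
  then have c_var: "has_bochner_integral ?P (\<lambda>w. (c w)\<^sup>2) (4 * t * \<tau> + 2 * \<tau>\<^sup>2)"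
    by (simp add: power2_eq_square algebra_simps)
  have lifted_time_eq: "lifted_time N w - (t + \<tau>) = (1 / real N) * (\<Sum>i<N. c (w i))" for w
    using N by (simp add: c_def sum_subtractf sum_divide_distrib[symmetric] field_simps)
  have c_mean': "has_bochner_integral (density lborel (normal_density (y i) (sqrt (2 * \<tau>)))) c 0"
    and c_var': "has_bochner_integral (density lborel (normal_density (y i) (sqrt (2 * \<tau>)))) (\<lambda>w. (c w)\<^sup>2) (4 * t * \<tau> + 2 * \<tau>\<^sup>2)"
    if "i \<in> {..<N}" for i
    using c_mean c_var y that by (simp_all add: m_def)
  have "has_bochner_integral (gauss {..<N} y \<tau>) (\<lambda>w. (1 / real N) * (\<Sum>i<N. c (w i))) ((1 / real N) * (\<Sum>i<N. 0))"
    by (intro has_bochner_integral_mult_right has_bochner_integral_sum gauss_component c_mean' \<tau>) auto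
  then show "has_bochner_integral (gauss {..<N} y \<tau>) (\<lambda>w. lifted_time N w - (t + \<tau>)) 0"
    unfolding lifted_time_eq by simp
  have "has_bochner_integral (gauss {..<N} y \<tau>) (\<lambda>w. (1 / real N)\<^sup>2 * (\<Sum>i<N. c (w i))\<^sup>2)
      ((1 / real N)\<^sup>2 * (\<Sum>i<N. 4 * t * \<tau> + 2 * \<tau>\<^sup>2))"
    by (intro has_bochner_integral_mult_right gauss_variance_sum c_mean' c_var' \<tau>) auto
  then show "has_bochner_integral (gauss {..<N} y \<tau>) (\<lambda>w. (lifted_time N w - (t + \<tau>))\<^sup>2) ((4 * t * \<tau> + 2 * \<tau>\<^sup>2) / real N)"
    unfolding lifted_time_eq power_mult_distrib
    using N by (simp add: power2_eq_square)
qed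

text \<open>
  Expand \<open>v (x', \<cdot>)\<close> to second order around \<open>t + \<tau>\<close>, the exact mean of the lifted time, for each
  fixed \<open>x'\<close>. The resulting variance bound does not depend on \<open>x'\<close> and survives the outer expectation.
  The factor \<open>1 / N\<close> gives the limit; that the bound is \<open>O (\<tau>)\<close> uniformly in \<open>N\<close> gives the
  integrability at \<open>\<tau> = 0\<close>.
\<close>

lemma heat_near_backward_heat:
  fixes v :: "'a::euclidean_space \<times> real \<Rightarrow> real"
  assumes \<tau>: "\<tau> > 0" and t: "t \<ge> 0" and N: "N \<ge> 1" and y: "\<And>i. i < N \<Longrightarrow> y i = sqrt (2 * t)"
    and v: "continuous_on UNIV v" and bound: "\<And>z. \<bar>v z\<bar> \<le> C"
    and lin: "\<And>z. linear (D z :: 'a \<times> real \<Rightarrow> real)"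
    and taylor: "\<And>z z'. \<bar>v z' - v z - D z (z' - z)\<bar> \<le> L * (norm (z' - z))\<^sup>2"
  shows "\<bar>heat N (radial_lift N v) (x, y) \<tau> - backward_heat v (x, t) \<tau>\<bar> \<le> L * ((4 * t * \<tau> + 2 * \<tau>\<^sup>2) / real N)"
proof -
  interpret X: prob_space "gauss_on x \<tau>" by (rule prob_space_gauss_on[OF \<tau>])
  interpret Y: prob_space "gauss {..<N} y \<tau>" by (rule prob_space_gauss[OF \<tau>])
  let ?F = "\<lambda>x'. \<integral>w. v (x', lifted_time N w) \<partial>gauss {..<N} y \<tau>"
  have inner: "\<bar>?F x' - v (x', t + \<tau>)\<bar> \<le> L * ((4 * t * \<tau> + 2 * \<tau>\<^sup>2) / real N)" for x'
  proof (rule Y.expectation_second_order_estimate)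
    show "integrable (gauss {..<N} y \<tau>) (\<lambda>w. v (x', lifted_time N w))"
      by (rule Y.integrable_const_bound[where B=C]) (use bound measurable_radial_slice[OF v] in auto)
    have "has_bochner_integral (gauss {..<N} y \<tau>)
       (\<lambda>w. (lifted_time N w - (t + \<tau>)) * D (x', t + \<tau>) (0, 1)) (0 * D (x', t + \<tau>) (0, 1))"
      by (intro has_bochner_integral_mult_left lifted_time_moments(1) \<tau> t N y)
    then show "has_bochner_integral (gauss {..<N} y \<tau>) (\<lambda>w. (lifted_time N w - (t + \<tau>)) * D (x', t + \<tau>) (0, 1)) 0"
      by simp
    show "has_bochner_integral (gauss {..<N} y \<tau>) (\<lambda>w. (lifted_time N w - (t + \<tau>))\<^sup>2) ((4 * t * \<tau> + 2 * \<tau>\<^sup>2) / real N)"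
      by (rule lifted_time_moments(2)[OF \<tau> t N y])
    fix w
    have "D (x', t + \<tau>) ((lifted_time N w - (t + \<tau>)) *\<^sub>R (0, 1)) = (lifted_time N w - (t + \<tau>)) * D (x', t + \<tau>) (0, 1)"
      by (simp only: linear_scale[OF lin] real_scaleR_def)
    then show "\<bar>v (x', lifted_time N w) - v (x', t + \<tau>) - (lifted_time N w - (t + \<tau>)) * D (x', t + \<tau>) (0, 1)\<bar>
        \<le> L * (lifted_time N w - (t + \<tau>))\<^sup>2"
      using taylor[of "(x', lifted_time N w)" "(x', t + \<tau>)"] by (simp add: norm_Pair)
  qed
  have mF: "?F \<in> borel_measurable (gauss_on x \<tau>)"
    using measurable_inner_expectation[OF \<tau> v] by (simp cong: measurable_cong_sets)
  have mv: "(\<lambda>x'. v (x', t + \<tau>)) \<in> borel_measurable (gauss_on x \<tau>)"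
    using measurable_slice(1)[OF v] by (simp cong: measurable_cong_sets)
  have "\<bar>?F x'\<bar> \<le> C" for x'
    by (rule Y.abs_expectation_le) (use bound measurable_radial_slice[OF v] in auto)
  then have "integrable (gauss_on x \<tau>) ?F"
    by (intro X.integrable_const_bound[where B=C] mF) auto
  moreover have "integrable (gauss_on x \<tau>) (\<lambda>x'. v (x', t + \<tau>))"
    by (rule X.integrable_const_bound[where B=C]) (use bound mv in auto)
  ultimately have "heat N (radial_lift N v) (x, y) \<tau> - backward_heat v (x, t) \<tau>
      = X.expectation (\<lambda>x'. ?F x' - v (x', t + \<tau>))"
    unfolding heat_radial_lift[OF \<tau> v bound]
      backward_heat_eq_gauss[OF \<tau> borel_measurable_continuous_onI[OF v]] by simp
  also have "\<bar>\<dots>\<bar> \<le> L * ((4 * t * \<tau> + 2 * \<tau>\<^sup>2) / real N)"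
    by (rule X.abs_expectation_le) (use mF mv inner in auto)
  finally show ?thesis .
qed

text \<open>
  Expansion around \<open>(x, t)\<close>: the spatial first-order term has mean zero, the spatial second-order term has
  mean \<open>2 \<tau> d\<close>, and the time increment is the deterministic \<open>\<tau>\<close>.
\<close>

lemma backward_heat_near_initial_value:
  fixes v :: "'a::euclidean_space \<times> real \<Rightarrow> real"
  assumes \<tau>: "\<tau> > 0"
    and v: "continuous_on UNIV v" and bound: "\<And>z. \<bar>v z\<bar> \<le> C"
    and lin: "\<And>z. linear (D z :: 'a \<times> real \<Rightarrow> real)"
    and taylor: "\<And>z z'. \<bar>v z' - v z - D z (z' - z)\<bar> \<le> L * (norm (z' - z))\<^sup>2"
  shows "\<bar>backward_heat v (x, t) \<tau> - (v (x, t) + \<tau> * D (x, t) (0, 1))\<bar> \<le> L * (2 * \<tau> * DIM('a) + \<tau>\<^sup>2)"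
proof -
  interpret X: prob_space "gauss_on x \<tau>" by (rule prob_space_gauss_on[OF \<tau>])
  show ?thesis
    unfolding backward_heat_eq_gauss[OF \<tau> borel_measurable_continuous_onI[OF v]]
  proof (rule X.expectation_second_order_estimate)
    show "integrable (gauss_on x \<tau>) (\<lambda>x'. v (x', t + \<tau>))"
      by (rule X.integrable_const_bound[where B=C])
        (use bound measurable_slice(1)[OF v] in \<open>auto cong: measurable_cong_sets\<close>)
    have "linear (\<lambda>h::'a. D (x, t) (h, 0))"
      by (rule linear_compose[OF _ lin, unfolded o_def]) (auto intro!: linearI)
    then show "has_bochner_integral (gauss_on x \<tau>) (\<lambda>x'. D (x, t) (x' - x, 0)) 0"
      by (rule gauss_on_mean[OF \<tau>])
    have "has_bochner_integral (gauss_on x \<tau>) (\<lambda>_. \<tau>\<^sup>2) (\<tau>\<^sup>2)"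
      by (simp add: has_bochner_integral_iff X.prob_space)
    then show "has_bochner_integral (gauss_on x \<tau>) (\<lambda>x'. (norm (x' - x))\<^sup>2 + \<tau>\<^sup>2) (2 * \<tau> * DIM('a) + \<tau>\<^sup>2)"
      by (rule has_bochner_integral_add[OF gauss_on_variance[OF \<tau>]])
    fix x'
    have "D (x, t) ((x' - x, 0) + \<tau> *\<^sub>R (0, 1)) = D (x, t) (x' - x, 0) + \<tau> * D (x, t) (0, 1)"
      by (simp only: linear_add[OF lin] linear_scale[OF lin] real_scaleR_def)
    then show "\<bar>v (x', t + \<tau>) - (v (x, t) + \<tau> * D (x, t) (0, 1)) - D (x, t) (x' - x, 0)\<bar> \<le> L * ((norm (x' - x))\<^sup>2 + \<tau>\<^sup>2)"
      using taylor[of "(x', t + \<tau>)" "(x, t)"] by (simp add: norm_Pair algebra_simps)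
  qed
qed


section \<open>Decay for large times, uniformly in the dimension\<close>

text \<open>
  The quantity \<open>sqrt (1 + 2 a / N) ^ N\<close> increases to \<open>exp a\<close> as \<open>N\<close> grows, so it should dominate any
  power of \<open>a\<close> uniformly. To obtain the power \<open>2 k\<close>, split the exponent into \<open>4 k\<close> blocks of length
  \<open>q = N div (4 k)\<close>; two blocks of square roots contribute one factor, at least
  \<open>1 + 2 a q / N \<ge> a / (4 k)\<close> by the Bernoulli inequality.
\<close>

lemma power_ge_of_bernoulli:
  fixes a :: real
  assumes k: "k \<ge> 1" and N: "N \<ge> 4 * k" and a: "a \<ge> 0"
  shows "(a / (4 * real k)) ^ (2 * k) \<le> sqrt (1 + 2 * a / real N) ^ N"
proof -
  define q where "q = N div (4 * k)"
  have q1: "q \<ge> 1" using N k by (simp add: q_def div_greater_zero_iff Suc_le_eq)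
  have "N mod (4 * k) < 4 * k" using k by simp
  then have "N < 4 * k * q + 4 * k" using mult_div_mod_eq[of "4 * k" N] unfolding q_def by linarith
  also have "\<dots> \<le> 4 * k * q + 4 * k * q" using q1 by simp
  finally have "real N \<le> real (8 * k * q)" by (subst of_nat_le_iff) simp
  then have "real N \<le> 8 * real k * real q" by simp
  moreover have N0: "real N > 0" using N k by simp
  ultimately have "a / (4 * real k) \<le> real q * (2 * a / real N)"
    using a k by (simp add: field_simps) (metis mult.assoc mult.commute mult_left_mono)
  also have "\<dots> \<le> 1 + real q * (2 * a / real N)" by simp
  also have "\<dots> \<le> (1 + 2 * a / real N) ^ q"
    using a N0 by (intro Bernoulli_inequality) (simp add: order_trans[of _ 0])
  finally have "(a / (4 * real k)) ^ (2 * k) \<le> ((1 + 2 * a / real N) ^ q) ^ (2 * k)"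
    using a by (intro power_mono) auto
  also have "\<dots> = sqrt (1 + 2 * a / real N) ^ (4 * k * q)"
  proof -
    have "(1 + 2 * a / real N) = sqrt (1 + 2 * a / real N) ^ 2" using a by (simp add: add_nonneg_nonneg)
    then have "((1 + 2 * a / real N) ^ q) ^ (2 * k) = ((sqrt (1 + 2 * a / real N) ^ 2) ^ q) ^ (2 * k)" by simp
    also have "\<dots> = sqrt (1 + 2 * a / real N) ^ (4 * k * q)"
      by (simp only: power_mult[symmetric]) (simp add: mult_ac)
    finally show ?thesis .
  qed
  also have "\<dots> \<le> sqrt (1 + 2 * a / real N) ^ N"
    using a by (intro power_increasing) (auto simp: q_def)
  finally show ?thesis .
qed

text \<open>
  A Chernoff bound at the level \<open>\<rho> = sqrt \<tau>\<close>. Where the lifted time \<open>r\<close> exceeds \<open>\<rho>\<close>, the hypothesis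
  on \<open>v\<close> gives \<open>|v| \<le> C / r ^ (2 k) \<le> C / \<tau> ^ k\<close>. Where \<open>r \<le> \<rho>\<close>, the bound \<open>|v| \<le> C\<close> is multiplied by
  \<open>exp (1 - r / \<rho>) \<ge> 1\<close>, and the expectation of this exponential is a value of the Laplace transform,
  at most of order \<open>\<rho> ^ - 2 k = \<tau> ^ - k\<close> once \<open>N \<ge> 4 k\<close>.
\<close>

lemma heat_radial_lift_decay:
  fixes v :: "'a::euclidean_space \<times> real \<Rightarrow> real"
  assumes \<tau>: "\<tau> > 0" and v: "continuous_on UNIV v" and bound: "\<And>z. \<bar>v z\<bar> \<le> C"
    and decay: "\<And>x r. \<bar>v (x, r)\<bar> * \<bar>r\<bar> ^ (2 * k) \<le> C" and C: "C > 0"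
    and k: "k \<ge> 1" and N: "N \<ge> 4 * k"
  shows "\<bar>heat N (radial_lift N v) (x, y) \<tau>\<bar> \<le> C * (exp 1 * (4 * real k) ^ (2 * k) + 1) / \<tau> ^ k"
proof (rule abs_heat_radial_lift_le[OF \<tau> v bound])
  fix x'
  interpret Y: prob_space "gauss {..<N} y \<tau>" by (rule prob_space_gauss[OF \<tau>])
  define \<rho> where "\<rho> = sqrt \<tau>"
  have \<rho>: "\<rho> > 0" "\<rho>\<^sup>2 = \<tau>" using \<tau> by (simp_all add: \<rho>_def)
  have N0: "N \<ge> 1" using N k by simp
  \<comment> \<open>With this parameter, exp (- l * |w|^2) is the Chernoff factor exp (- r / \<rho>) at the lifted time r of w.\<close>
  define l where "l = 1 / (2 * real N * \<rho>)"
  have l: "l \<ge> 0" "4 * l * \<tau> = 2 * \<rho> / real N" 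
    using \<rho> N0 by (simp_all add: l_def \<rho>(2)[symmetric] power2_eq_square)
  have le: "\<bar>v (x', r)\<bar> \<le> C * exp 1 * exp (- r / \<rho>) + C / \<tau> ^ k" if r: "r \<ge> 0" for r
  proof (cases "r \<le> \<rho>")
    case True
    then have "1 \<le> exp (1 + - r / \<rho>)" using \<rho> by simp
    then have "C * 1 \<le> C * (exp 1 * exp (- r / \<rho>))" using C unfolding exp_add by (intro mult_left_mono) auto
    then show ?thesis using bound[of "(x', r)"] C \<tau> by (smt (verit) divide_nonneg_pos mult.assoc mult_1_right zero_less_power)
  next
    case False
    then have r\<rho>: "\<rho> \<le> r" by simp
    have "\<tau> ^ k = \<rho> ^ (2 * k)" by (simp add: power_mult \<rho>)
    also have "\<dots> \<le> \<bar>r\<bar> ^ (2 * k)" using r\<rho> \<rho> by (intro power_mono) auto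
    finally have "\<bar>v (x', r)\<bar> * \<tau> ^ k \<le> \<bar>v (x', r)\<bar> * \<bar>r\<bar> ^ (2 * k)" by (intro mult_left_mono) auto
    also have "\<dots> \<le> C" by (rule decay)
    finally have "\<bar>v (x', r)\<bar> \<le> C / \<tau> ^ k" using \<tau> by (simp add: field_simps)
    moreover have "C * exp 1 * exp (- r / \<rho>) \<ge> 0" using C by simp
    ultimately show ?thesis by linarith
  qed
  have exp_eq: "exp (- lifted_time N w / \<rho>) = exp (- l * (\<Sum>i<N. (w i)\<^sup>2))" for w
    by (simp add: l_def)
  have expectation: "Y.expectation (\<lambda>w. exp (- lifted_time N w / \<rho>)) \<le> (4 * real k) ^ (2 * k) / \<tau> ^ k"
  proof -
    have "Y.expectation (\<lambda>w. exp (- lifted_time N w / \<rho>))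
       = exp (- l * (\<Sum>i<N. (y i)\<^sup>2) / (1 + 4 * l * \<tau>)) / sqrt (1 + 4 * l * \<tau>) ^ N"
      unfolding exp_eq using gauss_laplace[of "{..<N}" \<tau> l y] \<tau> l(1) by simp
    also have "\<dots> \<le> 1 / sqrt (1 + 4 * l * \<tau>) ^ N"
      using l(1) \<tau> by (intro divide_right_mono) (auto simp: sum_nonneg divide_nonneg_nonneg mult_nonneg_nonneg)
    also have "\<dots> \<le> 1 / (\<rho> / (4 * real k)) ^ (2 * k)"
      unfolding l(2) using power_ge_of_bernoulli[OF k N, of \<rho>] \<rho>(1) k
      by (intro divide_left_mono) (auto intro!: mult_pos_pos zero_less_power add_pos_nonneg)
    also have "\<dots> = (4 * real k) ^ (2 * k) / \<tau> ^ k"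
      by (simp add: power_divide power_mult \<rho>)
    finally show ?thesis .
  qed
  have [measurable]: "(\<lambda>w. v (x', lifted_time N w)) \<in> borel_measurable (gauss {..<N} y \<tau>)"
    by (rule measurable_radial_slice[OF v])
  have int_exp: "integrable (gauss {..<N} y \<tau>) (\<lambda>w. exp (- lifted_time N w / \<rho>))"
    by (rule Y.integrable_const_bound[where B=1]) (use \<rho> in \<open>auto simp: sum_nonneg\<close>)
  have "\<bar>Y.expectation (\<lambda>w. v (x', lifted_time N w))\<bar> \<le> Y.expectation (\<lambda>w. \<bar>v (x', lifted_time N w)\<bar>)"
    by (rule integral_abs_bound)
  also have "\<dots> \<le> Y.expectation (\<lambda>w. C * exp 1 * exp (- lifted_time N w / \<rho>) + C / \<tau> ^ k)"
  proof (rule integral_mono)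
    show "integrable (gauss {..<N} y \<tau>) (\<lambda>w. \<bar>v (x', lifted_time N w)\<bar>)"
      by (rule Y.integrable_const_bound[where B=C]) (use bound in auto)
    show "integrable (gauss {..<N} y \<tau>) (\<lambda>w. C * exp 1 * exp (- lifted_time N w / \<rho>) + C / \<tau> ^ k)"
      using int_exp by auto
    show "\<bar>v (x', lifted_time N w)\<bar> \<le> C * exp 1 * exp (- lifted_time N w / \<rho>) + C / \<tau> ^ k" for w
      by (rule le) (simp add: sum_nonneg)
  qed
  also have "\<dots> = C * exp 1 * Y.expectation (\<lambda>w. exp (- lifted_time N w / \<rho>)) + C / \<tau> ^ k"
    using int_exp by (simp add: Y.prob_space)
  also have "\<dots> \<le> C * exp 1 * ((4 * real k) ^ (2 * k) / \<tau> ^ k) + C / \<tau> ^ k"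
    using expectation C by (intro add_right_mono mult_left_mono) auto
  also have "\<dots> = C * (exp 1 * (4 * real k) ^ (2 * k) + 1) / \<tau> ^ k"
    by (simp add: add_divide_distrib ring_distribs mult.assoc)
  finally show "\<bar>Y.expectation (\<lambda>w. v (x', lifted_time N w))\<bar> \<le> C * (exp 1 * (4 * real k) ^ (2 * k) + 1) / \<tau> ^ k" .
qed

section \<open>Fractional powers\<close>

lemma frac_laplacian_cong:
  assumes "\<And>\<tau>. \<tau> > 0 \<Longrightarrow> heat N f z \<tau> = heat N f z' \<tau>" and "f z = f z'"
  shows "frac_laplacian N s f z = frac_laplacian N s f z'"
proof -
  have "(LINT \<tau>:{0<..}|lborel. (heat N f z \<tau> - f z) / \<tau> powr (1 + s))
      = (LINT \<tau>:{0<..}|lborel. (heat N f z' \<tau> - f z') / \<tau> powr (1 + s))"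
    "(LINT \<tau>:{0<..}|lborel. heat N f z \<tau> / \<tau> powr (1 + s))
      = (LINT \<tau>:{0<..}|lborel. heat N f z' \<tau> / \<tau> powr (1 + s))"
    using assms by (auto intro!: set_lebesgue_integral_cong)
  then show ?thesis using assms by (simp add: frac_laplacian_def Let_def)
qed

lemma borel_measurable_heat_radial_lift:
  fixes v :: "'a::euclidean_space \<times> real \<Rightarrow> real"
  assumes v: "continuous_on UNIV v"
  shows "heat N (radial_lift N v) z \<in> borel_measurable borel"
  using measurable_radial_lift[OF v, of N]
  by (intro borel_measurable_heat) (simp add: lebesgue_prod_def cong: measurable_cong_sets)

text \<open>
  All cases reduce to dominated convergence in \<open>\<tau>\<close>. For \<open>s > 0\<close> the numerator is \<open>O (\<tau>)\<close> near \<open>0\<close> and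
  bounded at infinity; for \<open>s < 0\<close> it is bounded near \<open>0\<close> and \<open>O (\<tau> ^ - d)\<close> at infinity, in dimension
  \<open>N \<ge> 4 d\<close>. The bounds \<open>s < 1\<close> and \<open>- d < s\<close> are the corresponding integrability conditions.
\<close>

lemma frac_laplacian_radial_lift_tendsto:
  fixes v :: "'a::euclidean_space \<times> real \<Rightarrow> real"
  assumes v: "schwartz v" and s: "- real DIM('a) < s" "s < 1" and t: "t \<ge> 0"
    and y: "\<And>N i. i < N \<Longrightarrow> y N i = sqrt (2 * t)"
  shows "(\<lambda>N. frac_laplacian N s (radial_lift N v) (x, y N)) \<longlonglongrightarrow> frac_backward_heat s v (x, t)"
proof -
  define d where "d = DIM('a)"
  have d1: "d \<ge> 1" using DIM_positive[where 'a='a] by (simp add: d_def Suc_le_eq)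
  obtain C where C: "C > 0" "\<And>z. \<bar>v z\<bar> \<le> C" "\<And>x r. \<bar>v (x, r)\<bar> * \<bar>r\<bar> ^ (2 * d) \<le> C"
    using schwartz_decay[OF v, of "2 * d"] by metis
  define D where "D = (\<lambda>z. frechet_derivative v (at z))"
  have der: "(v has_derivative D z) (at z)" for z
    using schwartz_differentiable[OF v, of "[]"] by (simp add: D_def)
  have cont: "continuous_on UNIV v"
    using der by (intro continuous_at_imp_continuous_on ballI has_derivative_continuous) auto
  have lin: "linear (D z)" for z by (rule has_derivative_linear[OF der])
  obtain L where L: "L \<ge> 0" "\<And>z z'. \<bar>v z' - v z - D z (z' - z)\<bar> \<le> L * (norm (z' - z))\<^sup>2"
    using schwartz_second_order_taylor[OF v] unfolding D_def by metis
  let ?h = "\<lambda>N. heat N (radial_lift N v) (x, y N)"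
  have lift: "radial_lift N v (x, y N) = v (x, t)" if "N \<ge> 1" for N
    using that t y by (simp add: radial_lift_eq)
  have near: "\<bar>?h N \<tau> - backward_heat v (x, t) \<tau>\<bar> \<le> L * ((4 * t * \<tau> + 2 * \<tau>\<^sup>2) / real N)"
    if "\<tau> > 0" "N \<ge> 1" for N \<tau>
    by (rule heat_near_backward_heat[OF that(1) t that(2) y cont C(2) lin L(2)])
  have lim: "(\<lambda>N. ?h N \<tau>) \<longlonglongrightarrow> backward_heat v (x, t) \<tau>" if \<tau>: "\<tau> > 0" for \<tau>
  proof (rule Lim_transform[OF tendsto_const])
    show "(\<lambda>N. ?h N \<tau> - backward_heat v (x, t) \<tau>) \<longlonglongrightarrow> 0"
    proof (rule Lim_null_comparison)
      show "\<forall>\<^sub>F N in sequentially. norm (?h N \<tau> - backward_heat v (x, t) \<tau>) \<le> L * ((4 * t * \<tau> + 2 * \<tau>\<^sup>2) / real N)"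
        using eventually_ge_at_top[of 1] by eventually_elim (use near[OF \<tau>] in auto)
      show "(\<lambda>N. L * ((4 * t * \<tau> + 2 * \<tau>\<^sup>2) / real N)) \<longlonglongrightarrow> 0"
        by real_asymp
    qed
  qed
  have bounded: "\<bar>?h N \<tau>\<bar> \<le> C" if \<tau>: "\<tau> > 0" for N \<tau>
  proof (rule abs_heat_radial_lift_le[OF \<tau> cont C(2)])
    interpret Y: prob_space "gauss {..<N} (y N) \<tau>" by (rule prob_space_gauss[OF \<tau>])
    show "\<bar>\<integral>w. v (x', lifted_time N w) \<partial>gauss {..<N} (y N) \<tau>\<bar> \<le> C" for x'
      by (rule Y.abs_expectation_le) (use C measurable_radial_slice[OF cont] in auto)
  qed
  consider "s > 0" | "s = 0" | "s < 0" by linarith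
  then show ?thesis
  proof cases
    case 1
    \<comment> \<open>The three terms bound heat minus backward heat, the drift in time, and the Taylor remainder of the backward heat, for \<tau> at most 1; 2 * C serves for larger \<tau>.\<close>
    define K where "K = max (2 * C) (L * (4 * t + 2) + \<bar>D (x, t) (0, 1)\<bar> + L * (2 * real d + 1))"
    have small: "\<bar>?h N \<tau> - v (x, t)\<bar> \<le> K * \<tau>" if \<tau>: "\<tau> > 0" "\<tau> \<le> 1" and N: "N \<ge> 1" for N \<tau>
    proof -
      have sq: "\<tau>\<^sup>2 \<le> \<tau>" using \<tau> by (simp add: power2_eq_square mult_left_le_one_le)
      have "(4 * t * \<tau> + 2 * \<tau>\<^sup>2) / real N \<le> (4 * t * \<tau> + 2 * \<tau>\<^sup>2) / 1"
        using N \<tau> t by (intro divide_left_mono) auto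
      also have "\<dots> \<le> (4 * t + 2) * \<tau>" using sq by (simp add: algebra_simps)
      finally have "L * ((4 * t * \<tau> + 2 * \<tau>\<^sup>2) / real N) \<le> L * ((4 * t + 2) * \<tau>)"
        using L(1) by (intro mult_left_mono)
      then have 1: "\<bar>?h N \<tau> - backward_heat v (x, t) \<tau>\<bar> \<le> L * ((4 * t + 2) * \<tau>)"
        using near[OF \<tau>(1) N] by linarith
      have "L * (2 * \<tau> * DIM('a) + \<tau>\<^sup>2) \<le> L * ((2 * real d + 1) * \<tau>)"
        using L(1) sq by (intro mult_left_mono) (simp_all add: d_def algebra_simps)
      then have 2: "\<bar>backward_heat v (x, t) \<tau> - (v (x, t) + \<tau> * D (x, t) (0, 1))\<bar> \<le> L * ((2 * real d + 1) * \<tau>)"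
        using backward_heat_near_initial_value[where D=D, OF \<tau>(1) cont C(2) lin L(2), of x t] by linarith
      have 3: "\<bar>\<tau> * D (x, t) (0, 1)\<bar> = \<bar>D (x, t) (0, 1)\<bar> * \<tau>" using \<tau> by (simp add: abs_mult)
      have "\<bar>?h N \<tau> - v (x, t)\<bar> \<le> L * ((4 * t + 2) * \<tau>) + \<bar>D (x, t) (0, 1)\<bar> * \<tau> + L * ((2 * real d + 1) * \<tau>)"
        using 1 2 3 by linarith
      also have "\<dots> = (L * (4 * t + 2) + \<bar>D (x, t) (0, 1)\<bar> + L * (2 * real d + 1)) * \<tau>"
        by (simp add: algebra_simps)
      also have "\<dots> \<le> K * \<tau>" using \<tau> by (intro mult_right_mono) (auto simp: K_def)
      finally show ?thesis .
    qed
    have "(\<lambda>N. LINT \<tau>:{0<..}|lborel. (?h N \<tau> - v (x, t)) / \<tau> powr (1 + s))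
        \<longlonglongrightarrow> (LINT \<tau>:{0<..}|lborel. (backward_heat v (x, t) \<tau> - v (x, t)) / \<tau> powr (1 + s))"
    proof (rule tendsto_singular_integral[where a=1 and b=0 and ?n0.0=1 and C=K])
      show "(\<lambda>\<tau>. ?h N \<tau> - v (x, t)) \<in> borel_measurable borel" for N
        using borel_measurable_heat_radial_lift[OF cont] by simp
      show "(\<lambda>N. ?h N \<tau> - v (x, t)) \<longlonglongrightarrow> backward_heat v (x, t) \<tau> - v (x, t)" if "\<tau> > 0" for \<tau>
        by (intro tendsto_diff lim that tendsto_const)
      show "\<bar>?h N \<tau> - v (x, t)\<bar> \<le> K * (if \<tau> \<le> 1 then \<tau> powr 1 else \<tau> powr 0)"
        if "N \<ge> 1" "\<tau> > 0" for N \<tau>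
      proof (cases "\<tau> \<le> 1")
        case True
        then show ?thesis using small[of \<tau> N] that by simp
      next
        case False
        have "\<bar>?h N \<tau> - v (x, t)\<bar> \<le> 2 * C"
          using bounded[OF that(2), of N] C(2)[of "(x, t)"] by linarith
        then show ?thesis using False that by (simp add: K_def)
      qed
    qed (use s 1 in auto)
    then have "(\<lambda>N. 1 / Gamma (- s) * (LINT \<tau>:{0<..}|lborel. (?h N \<tau> - v (x, t)) / \<tau> powr (1 + s)))
        \<longlonglongrightarrow> frac_backward_heat s v (x, t)"
      using 1 by (simp only: frac_backward_heat_def if_True) (intro tendsto_mult tendsto_const)
    then show ?thesis
    proof (rule Lim_transform_eventually)
      show "\<forall>\<^sub>F N in sequentially. 1 / Gamma (- s) * (LINT \<tau>:{0<..}|lborel. (?h N \<tau> - v (x, t)) / \<tau> powr (1 + s))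
          = frac_laplacian N s (radial_lift N v) (x, y N)"
        using eventually_ge_at_top[of 1]
        by eventually_elim (use 1 lift in \<open>simp add: frac_laplacian_def\<close>)
    qed
  next
    case 2
    then have "frac_backward_heat s v (x, t) = v (x, t)" by (simp add: frac_backward_heat_def)
    moreover have "\<forall>\<^sub>F N in sequentially. v (x, t) = frac_laplacian N s (radial_lift N v) (x, y N)"
      using eventually_ge_at_top[of 1]
      by eventually_elim (use 2 lift in \<open>simp add: frac_laplacian_def\<close>)
    ultimately show ?thesis by (auto intro: Lim_transform_eventually[OF tendsto_const])
  next
    case 3
    define K where "K = max C (C * (exp 1 * (4 * real d) ^ (2 * d) + 1))"
    have "(\<lambda>N. LINT \<tau>:{0<..}|lborel. ?h N \<tau> / \<tau> powr (1 + s))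
        \<longlonglongrightarrow> (LINT \<tau>:{0<..}|lborel. backward_heat v (x, t) \<tau> / \<tau> powr (1 + s))"
    proof (rule tendsto_singular_integral[where a=0 and b="- real d" and ?n0.0="4 * d" and C=K])
      show "?h N \<in> borel_measurable borel" for N
        by (rule borel_measurable_heat_radial_lift[OF cont])
      show "(\<lambda>N. ?h N \<tau>) \<longlonglongrightarrow> backward_heat v (x, t) \<tau>" if "\<tau> > 0" for \<tau>
        by (rule lim[OF that])
      show "\<bar>?h N \<tau>\<bar> \<le> K * (if \<tau> \<le> 1 then \<tau> powr 0 else \<tau> powr - real d)"
        if "N \<ge> 4 * d" "\<tau> > 0" for N \<tau>
      proof (cases "\<tau> \<le> 1")
        case True
        then show ?thesis using bounded[OF that(2), of N] that by (simp add: K_def)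
      next
        case False
        have "\<bar>?h N \<tau>\<bar> \<le> C * (exp 1 * (4 * real d) ^ (2 * d) + 1) / \<tau> ^ d"
          by (rule heat_radial_lift_decay[OF that(2) cont C(2) C(3) C(1) d1 that(1)])
        also have "\<dots> \<le> K / \<tau> ^ d"
          using that by (intro divide_right_mono) (auto simp: K_def)
        also have "\<dots> = K * \<tau> powr - real d"
          using that by (simp add: powr_minus powr_realpow divide_inverse)
        finally show ?thesis using False by simp
      qed
    qed (use s 3 in \<open>auto simp: d_def\<close>)
    then have "(\<lambda>N. 1 / Gamma (- s) * (LINT \<tau>:{0<..}|lborel. ?h N \<tau> / \<tau> powr (1 + s)))
        \<longlonglongrightarrow> 1 / Gamma (- s) * (LINT \<tau>:{0<..}|lborel. backward_heat v (x, t) \<tau> / \<tau> powr (1 + s))"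
      by (intro tendsto_mult tendsto_const)
    then show ?thesis using 3 by (simp add: frac_laplacian_def frac_backward_heat_def Let_def)
  qed
qed

lemma radial_lift_even_extension: "radial_lift N (even_extension u) = radial_lift N u"
  by (auto simp: radial_lift_def even_extension_def)

lemma frac_backward_heat_even_extension:
  assumes "t \<ge> 0"
  shows "frac_backward_heat s (even_extension u) (x, t) = frac_backward_heat s u (x, t)"
proof -
  have b: "backward_heat (even_extension u) (x, t) \<tau> = backward_heat u (x, t) \<tau>" if "\<tau> > 0" for \<tau>
    using assms that by (simp add: backward_heat_def even_extension_def)
  have u: "even_extension u (x, t) = u (x, t)"
    using assms by (simp add: even_extension_def)
  have "(LINT \<tau>:{0<..}|lborel. (backward_heat (even_extension u) (x, t) \<tau> - u (x, t)) / \<tau> powr (1 + s))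
      = (LINT \<tau>:{0<..}|lborel. (backward_heat u (x, t) \<tau> - u (x, t)) / \<tau> powr (1 + s))"
    "(LINT \<tau>:{0<..}|lborel. backward_heat (even_extension u) (x, t) \<tau> / \<tau> powr (1 + s))
      = (LINT \<tau>:{0<..}|lborel. backward_heat u (x, t) \<tau> / \<tau> powr (1 + s))"
    by (auto intro!: set_lebesgue_integral_cong simp: b)
  then show ?thesis by (simp add: frac_backward_heat_def Let_def u)
qed

text \<open>
  The representative of the sphere \<open>|y|\<^sup>2 / (2 N) = t\<close>, used both to define the radial profile and to compute
  the limit.
\<close>

definition diagonal_point :: "nat \<Rightarrow> real \<Rightarrow> nat \<Rightarrow> real" where
  "diagonal_point N t = (\<lambda>i\<in>{..<N}. sqrt (2 * t))"

lemma diagonal_point_in_Rn: "diagonal_point N t \<in> Rn N"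
  by (auto simp: diagonal_point_def Rn_def)

lemma sum_diagonal_point: "t \<ge> 0 \<Longrightarrow> (\<Sum>i<N. (diagonal_point N t i)\<^sup>2) = 2 * real N * t"
  by (simp add: diagonal_point_def)

lemma frac_laplacian_radial_lift_radial:
  fixes v :: "'a::euclidean_space \<times> real \<Rightarrow> real"
  assumes v: "schwartz v" and N: "N \<ge> 1"
  shows "frac_laplacian N s (radial_lift N v) (x, y)
      = frac_laplacian N s (radial_lift N v) (x, diagonal_point N (lifted_time N y))"
proof -
  obtain C where C: "\<And>z. \<bar>v z\<bar> \<le> C" "\<And>x r. \<bar>v (x, r)\<bar> * \<bar>r\<bar> ^ 1 \<le> C"
    using schwartz_decay[OF v, of 1] by metis
  have cont: "continuous_on UNIV v"
    using schwartz_differentiable[OF v, of "[]"]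
    by (intro continuous_at_imp_continuous_on ballI has_derivative_continuous) auto
  have sums: "(\<Sum>i<N. (y i)\<^sup>2) = (\<Sum>i<N. (diagonal_point N (lifted_time N y) i)\<^sup>2)"
    using N by (subst sum_diagonal_point) (auto simp: sum_nonneg divide_nonneg_nonneg)
  show ?thesis
    by (rule frac_laplacian_cong)
      (use heat_radial_lift_rotation_invariant[OF _ cont C(1) _ N sums] C(2) sums in \<open>auto simp: radial_lift_eq\<close>)
qed

theorem proposition3p1:
  fixes u :: "(real ^ 'd) \<times> real \<Rightarrow> real" and s :: real
  assumes s_bounds: "- real CARD('d) < s" "s < 1"
    and u_schwartz: "schwartz (even_extension u)"
  shows "(\<forall>N\<ge>1. \<exists>G :: (real ^ 'd) \<times> real \<Rightarrow> real. \<forall>x. \<forall>y\<in>Rn N.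
            frac_laplacian N s (radial_lift N u) (x, y) = G (x, L2_set y {..<N} ^ 2 / (2 * real N)))
       \<and> (\<forall>G :: nat \<Rightarrow> (real ^ 'd) \<times> real \<Rightarrow> real.
            (\<forall>N\<ge>1. \<forall>x. \<forall>y\<in>Rn N.
               G N (x, L2_set y {..<N} ^ 2 / (2 * real N)) =
               frac_laplacian N s (radial_lift N u) (x, y))
            \<longrightarrow> (\<forall>x. \<forall>t\<ge>0. (\<lambda>N. G N (x, t)) \<longlonglongrightarrow> frac_backward_heat s u (x, t)))"
proof (intro conjI allI impI)
  fix N :: nat assume N: "N \<ge> 1"
  show "\<exists>G :: (real ^ 'd) \<times> real \<Rightarrow> real. \<forall>x. \<forall>y\<in>Rn N.
      frac_laplacian N s (radial_lift N u) (x, y) = G (x, L2_set y {..<N} ^ 2 / (2 * real N))"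
  proof (intro exI allI ballI)
    fix x y
    show "frac_laplacian N s (radial_lift N u) (x, y)
        = (\<lambda>(x, r). frac_laplacian N s (radial_lift N u) (x, diagonal_point N r)) (x, L2_set y {..<N} ^ 2 / (2 * real N))"
      using frac_laplacian_radial_lift_radial[OF u_schwartz N, of s x y]
      by (simp add: radial_lift_even_extension L2_set_square)
  qed
next
  fix G :: "nat \<Rightarrow> (real ^ 'd) \<times> real \<Rightarrow> real" and x t
  assume G: "\<forall>N\<ge>1. \<forall>x. \<forall>y\<in>Rn N. G N (x, L2_set y {..<N} ^ 2 / (2 * real N)) =
      frac_laplacian N s (radial_lift N u) (x, y)" and t: "0 \<le> (t::real)"
  have "(\<lambda>N. frac_laplacian N s (radial_lift N (even_extension u)) (x, diagonal_point N t))
      \<longlonglongrightarrow> frac_backward_heat s (even_extension u) (x, t)"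
    by (rule frac_laplacian_radial_lift_tendsto[OF u_schwartz])
      (use s_bounds t in \<open>auto simp: diagonal_point_def\<close>)
  then have "(\<lambda>N. frac_laplacian N s (radial_lift N u) (x, diagonal_point N t))
      \<longlonglongrightarrow> frac_backward_heat s u (x, t)"
    by (simp add: radial_lift_even_extension frac_backward_heat_even_extension[OF t])
  then show "(\<lambda>N. G N (x, t)) \<longlonglongrightarrow> frac_backward_heat s u (x, t)"
  proof (rule Lim_transform_eventually)
    show "\<forall>\<^sub>F N in sequentially. frac_laplacian N s (radial_lift N u) (x, diagonal_point N t) = G N (x, t)"
      using eventually_ge_at_top[of 1]
    proof eventually_elim
      fix N :: nat assume N: "N \<ge> 1"
      have "L2_set (diagonal_point N t) {..<N} ^ 2 / (2 * real N) = t"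
        using N t by (simp add: L2_set_square sum_diagonal_point)
      then show "frac_laplacian N s (radial_lift N u) (x, diagonal_point N t) = G N (x, t)"
        using G N diagonal_point_in_Rn[of N t] by metis
    qed
  qed
qed

end
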